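(* For every integer $k\ge 1$ there is a constant $C_k>0$ such that $$\mathrm{A}(n,k)\ \ge\ C_k\, n^{k^3-3k^2-3k+3}\qquad\text{for all integers } n\ge 1,$$ where $\mathrm{A}(n,k):=\max\{g(\lambda,\mu,\nu):\ \lambda,\mu,\nu\vdash n,\ \ell(\lambda),\ell(\mu),\ell(\nu)\le k\}$.
   Context: For a partition $\lambda\vdash n$, $\ell(\lambda)$ denotes its length (number of nonzero parts). For $\lambda,\mu,\nu\vdash n$ the Kronecker coefficient is $g(\lambda,\mu,\nu)=\frac{1}{n!}\sum_{\sigma\in S_n}\chi^\lambda(\sigma)\chi^\mu(\sigma)\chi^\nu(\sigma)$, where $\chi^\alpha$ is the irreducible character of the symmetric group $S_n$ (Specht module) indexed by $\alpha\vdash n$. *)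

theory Defs
  imports
    Complex_Main
    "HOL-Library.Function_Algebras"
    "HOL-Combinatorics.Permutations"
begin

section \<open>Traces of linear operators on spaces of complex-valued functions\<close>

text \<open>The complex vector space of all functions from \<open>'a\<close> to \<open>complex\<close>, with the pointwise
  addition of \<open>Function_Algebras\<close>. The prefix \<open>cfun\<close> gives access to \<open>cfun.span\<close>,
  \<open>cfun.independent\<close>, \<open>cfun.representation\<close>, etc.\<close>

definition cscale :: "complex \<Rightarrow> ('a \<Rightarrow> complex) \<Rightarrow> 'a \<Rightarrow> complex" where
  "cscale c f = (\<lambda>x. c * f x)"

interpretation cfun: vector_space "cscale :: complex \<Rightarrow> ('a \<Rightarrow> complex) \<Rightarrow> 'a \<Rightarrow> complex"
  by unfold_locales (auto simp: cscale_def algebra_simps fun_eq_iff)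

text \<open>The trace of \<open>T\<close> on a finite-dimensional \<open>T\<close>-invariant subspace \<open>V\<close>; the choice of the basis
  is irrelevant by \<open>trace_on_eq\<close> below.\<close>

definition trace_on :: "('a \<Rightarrow> complex) set \<Rightarrow> (('a \<Rightarrow> complex) \<Rightarrow> 'a \<Rightarrow> complex) \<Rightarrow> complex" where
  "trace_on V T =
     (let B = (SOME B. B \<subseteq> V \<and> cfun.independent B \<and> cfun.span B = V)
      in \<Sum>b\<in>B. cfun.representation B (T b) b)"

section \<open>Partitions and Specht modules\<close>

definition is_partition :: "nat list \<Rightarrow> nat \<Rightarrow> bool" (infix \<open>\<turnstile>\<close> 50) where
  "lam \<turnstile> n \<longleftrightarrow> sorted_wrt (\<ge>) lam \<and> 0 \<notin> set lam \<and> sum_list lam = n"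

text \<open>Rows and columns are numbered from 0, and the symmetric group on \<open>n\<close> letters consists of
  the permutations of \<open>{..<n}\<close>.\<close>

definition diagram :: "nat list \<Rightarrow> (nat \<times> nat) set" where
  "diagram lam = {(i, j). i < length lam \<and> j < lam ! i}"

definition tableaux :: "nat list \<Rightarrow> (nat \<times> nat \<Rightarrow> nat) set" where
  "tableaux lam = {t. bij_betw t (diagram lam) {..<sum_list lam}}"

definition col :: "nat list \<Rightarrow> (nat \<times> nat \<Rightarrow> nat) \<Rightarrow> nat \<Rightarrow> nat set" where
  "col lam t j = t ` {p \<in> diagram lam. snd p = j}"

text \<open>A tabloid, i.e. a class of tableaux modulo permutations of the entries within each row, is
  encoded by the sequence of its sets of row entries.\<close>

definition tabloid :: "nat list \<Rightarrow> (nat \<times> nat \<Rightarrow> nat) \<Rightarrow> nat \<Rightarrow> nat set" where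
  "tabloid lam t i = t ` {p \<in> diagram lam. fst p = i}"

definition column_stabilizer :: "nat list \<Rightarrow> (nat \<times> nat \<Rightarrow> nat) \<Rightarrow> (nat \<Rightarrow> nat) set" where
  "column_stabilizer lam t =
     {\<pi>. \<pi> permutes {..<sum_list lam} \<and> (\<forall>j. \<pi> ` col lam t j = col lam t j)}"

text \<open>Formal linear combinations of tabloids are functions giving the coefficient of each tabloid.
  The permutation \<open>\<sigma>\<close> sends the tabloid \<open>T\<close> to \<open>\<lambda>i. \<sigma> ` T i\<close>; on coefficient functions this is
  precomposition with the inverse.\<close>

definition perm_act :: "(nat \<Rightarrow> nat) \<Rightarrow> ((nat \<Rightarrow> nat set) \<Rightarrow> complex) \<Rightarrow> (nat \<Rightarrow> nat set) \<Rightarrow> complex" where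
  "perm_act \<sigma> f = (\<lambda>T. f (\<lambda>i. inv \<sigma> ` T i))"

definition polytabloid :: "nat list \<Rightarrow> (nat \<times> nat \<Rightarrow> nat) \<Rightarrow> (nat \<Rightarrow> nat set) \<Rightarrow> complex" where
  "polytabloid lam t = (\<lambda>T. \<Sum>\<pi>\<in>column_stabilizer lam t.
     of_int (sign \<pi>) * (if T = tabloid lam (\<pi> \<circ> t) then 1 else 0))"

definition specht :: "nat list \<Rightarrow> ((nat \<Rightarrow> nat set) \<Rightarrow> complex) set" where
  "specht lam = cfun.span (polytabloid lam ` tableaux lam)"

definition specht_char :: "nat list \<Rightarrow> (nat \<Rightarrow> nat) \<Rightarrow> complex" where
  "specht_char lam \<sigma> = trace_on (specht lam) (perm_act \<sigma>)"

section \<open>Kronecker coefficients\<close>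

definition kronecker :: "nat \<Rightarrow> nat list \<Rightarrow> nat list \<Rightarrow> nat list \<Rightarrow> complex" where
  "kronecker n lam mu nu =
     (\<Sum>\<sigma> | \<sigma> permutes {..<n}. specht_char lam \<sigma> * specht_char mu \<sigma> * specht_char nu \<sigma>) / fact n"

text \<open>The real part only serves to move to an ordered type: Kronecker coefficients are real, see
  \<open>kronecker_in_Reals\<close> below.\<close>

definition max_kronecker :: "nat \<Rightarrow> nat \<Rightarrow> real" where
  "max_kronecker n k = Max {Re (kronecker n lam mu nu) | lam mu nu.
     lam \<turnstile> n \<and> mu \<turnstile> n \<and> nu \<turnstile> n \<and> length lam \<le> k \<and> length mu \<le> k \<and> length nu \<le> k}"

section \<open>Well-definedness\<close>

lemma cfun_trace_basis_indep:
  fixes T :: "('a \<Rightarrow> complex) \<Rightarrow> 'a \<Rightarrow> complex"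
  assumes lin: "Vector_Spaces.linear cscale cscale T"
    and inv: "\<And>v. v \<in> V \<Longrightarrow> T v \<in> V"
    and B: "finite B" "cfun.independent B" "cfun.span B = V"
    and B': "finite B'" "cfun.independent B'" "cfun.span B' = V"
  shows "(\<Sum>b\<in>B. cfun.representation B (T b) b) = (\<Sum>b\<in>B'. cfun.representation B' (T b) b)"
proof -
  interpret T: Vector_Spaces.linear cscale cscale T by (fact lin)
  have V: "b \<in> V" if "b \<in> B \<or> b \<in> B'" for b
    using that B(3) B'(3) cfun.span_superset by blast
  have 1: "cfun.representation B (T b) b =
      (\<Sum>b'\<in>B'. cfun.representation B' b b' * cfun.representation B (T b') b)" if "b \<in> B" for b
  proof -
    have "b = (\<Sum>b'\<in>B'. cscale (cfun.representation B' b b') b')"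
      by (rule cfun.sum_representation_eq[symmetric]) (use B' V that in auto)
    then have "T b = T (\<Sum>b'\<in>B'. cscale (cfun.representation B' b b') b')" by simp
    also have "\<dots> = (\<Sum>b'\<in>B'. cscale (cfun.representation B' b b') (T b'))"
      by (simp add: T.sum T.scale)
    finally have "T b = (\<Sum>b'\<in>B'. cscale (cfun.representation B' b b') (T b'))" .
    then have "cfun.representation B (T b) b =
        cfun.representation B (\<Sum>b'\<in>B'. cscale (cfun.representation B' b b') (T b')) b" by simp
    also have "\<dots> = (\<Sum>b'\<in>B'. cfun.representation B (cscale (cfun.representation B' b b') (T b')) b)"
      by (subst cfun.representation_sum) (use B V inv in \<open>auto intro!: cfun.span_scale\<close>)
    also have "\<dots> = (\<Sum>b'\<in>B'. cfun.representation B' b b' * cfun.representation B (T b') b)"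
      by (intro sum.cong refl, subst cfun.representation_scale) (use B V inv in auto)
    finally show ?thesis .
  qed
  have 2: "cfun.representation B' (T b') b' =
      (\<Sum>b\<in>B. cfun.representation B (T b') b * cfun.representation B' b b')" if "b' \<in> B'" for b'
  proof -
    have "T b' = (\<Sum>b\<in>B. cscale (cfun.representation B (T b') b) b)"
      by (rule cfun.sum_representation_eq[symmetric]) (use B V inv that in auto)
    then have "cfun.representation B' (T b') b' =
        cfun.representation B' (\<Sum>b\<in>B. cscale (cfun.representation B (T b') b) b) b'" by simp
    also have "\<dots> = (\<Sum>b\<in>B. cfun.representation B' (cscale (cfun.representation B (T b') b) b) b')"
      by (subst cfun.representation_sum) (use B' V inv in \<open>auto intro!: cfun.span_scale\<close>)
    also have "\<dots> = (\<Sum>b\<in>B. cfun.representation B (T b') b * cfun.representation B' b b')"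
      by (intro sum.cong refl, subst cfun.representation_scale) (use B' V inv in auto)
    finally show ?thesis .
  qed
  show ?thesis
    by (simp add: 1 2) (subst sum.swap, simp add: mult.commute)
qed

lemma trace_on_eq:
  fixes T :: "('a \<Rightarrow> complex) \<Rightarrow> 'a \<Rightarrow> complex"
  assumes lin: "Vector_Spaces.linear cscale cscale T"
    and inv: "\<And>v. v \<in> V \<Longrightarrow> T v \<in> V"
    and B: "finite B" "cfun.independent B" "cfun.span B = V"
  shows "trace_on V T = (\<Sum>b\<in>B. cfun.representation B (T b) b)"
proof -
  define B' where "B' = (SOME B. B \<subseteq> V \<and> cfun.independent B \<and> cfun.span B = V)"
  have "\<exists>B. B \<subseteq> V \<and> cfun.independent B \<and> cfun.span B = V"
    using B cfun.span_superset by blast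
  then have B': "B' \<subseteq> V \<and> cfun.independent B' \<and> cfun.span B' = V"
    unfolding B'_def by (rule someI_ex)
  then have "finite B'"
    using cfun.independent_span_bound[of B B'] B by auto
  with cfun_trace_basis_indep[OF lin inv B, of B'] B' show ?thesis
    by (simp add: trace_on_def B'_def[symmetric])
qed

lemma linear_perm_act: "Vector_Spaces.linear cscale cscale (perm_act \<sigma>)"
  by unfold_locales (auto simp: perm_act_def cscale_def fun_eq_iff algebra_simps)

lemma perm_act_polytabloid:
  assumes \<sigma>: "\<sigma> permutes {..<sum_list lam}"
  shows "perm_act \<sigma> (polytabloid lam t) = polytabloid lam (\<sigma> \<circ> t)"
proof
  fix T :: "nat \<Rightarrow> nat set"
  let ?h = "\<lambda>\<pi>. \<sigma> \<circ> \<pi> \<circ> inv \<sigma>" and ?h' = "\<lambda>\<pi>. inv \<sigma> \<circ> \<pi> \<circ> \<sigma>"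
  have bij: "bij \<sigma>" using \<sigma> by (rule permutes_bij)
  have inv1: "inv \<sigma> (\<sigma> x) = x" and inv2: "\<sigma> (inv \<sigma> x) = x" for x
    using permutes_inverses[OF \<sigma>] by auto
  have pinv: "inv \<sigma> permutes {..<sum_list lam}" using \<sigma> by (rule permutes_inv)
  have col: "col lam (\<sigma> \<circ> t) j = \<sigma> ` col lam t j" for j
    by (simp add: col_def image_comp)
  have 1: "?h \<pi> \<in> column_stabilizer lam (\<sigma> \<circ> t)" if "\<pi> \<in> column_stabilizer lam t" for \<pi>
  proof -
    have "\<pi> permutes {..<sum_list lam}" "\<And>j. \<pi> ` col lam t j = col lam t j"
      using that by (auto simp: column_stabilizer_def)
    moreover have "?h \<pi> ` \<sigma> ` A = \<sigma> ` \<pi> ` A" for A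
      by (simp add: image_image inv1)
    ultimately show ?thesis
      using \<sigma> pinv by (simp only: column_stabilizer_def col mem_Collect_eq) (blast intro: permutes_compose)
  qed
  have 2: "?h' \<pi> \<in> column_stabilizer lam t" if "\<pi> \<in> column_stabilizer lam (\<sigma> \<circ> t)" for \<pi>
  proof -
    have "\<pi> permutes {..<sum_list lam}" and c: "\<And>j. \<pi> ` \<sigma> ` col lam t j = \<sigma> ` col lam t j"
      using that by (auto simp: column_stabilizer_def col)
    moreover have "?h' \<pi> ` A = inv \<sigma> ` \<pi> ` \<sigma> ` A" for A
      by (simp add: image_image)
    moreover have "inv \<sigma> ` \<sigma> ` A = A" for A
      by (simp add: image_image inv1)
    ultimately show ?thesis
      using \<sigma> pinv by (simp add: column_stabilizer_def permutes_compose)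
  qed
  have sgn: "sign (?h \<pi>) = sign \<pi>" if "\<pi> \<in> column_stabilizer lam t" for \<pi>
  proof -
    have "permutation \<sigma>" "permutation \<pi>"
      using \<sigma> that by (auto simp: column_stabilizer_def intro: permutes_imp_permutation)
    then show ?thesis
      by (simp add: sign_compose sign_inverse permutation_compose permutation_inverse)
  qed
  have tab: "T = tabloid lam (?h \<pi> \<circ> (\<sigma> \<circ> t)) \<longleftrightarrow> (\<lambda>i. inv \<sigma> ` T i) = tabloid lam (\<pi> \<circ> t)" for \<pi>
  proof -
    have *: "tabloid lam (?h \<pi> \<circ> (\<sigma> \<circ> t)) i = \<sigma> ` tabloid lam (\<pi> \<circ> t) i" for i
      by (simp add: tabloid_def image_image inv1)
    have "T i = \<sigma> ` A \<longleftrightarrow> inv \<sigma> ` T i = A" for i A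
      by (auto simp: image_image inv1 inv2)
    then show ?thesis by (simp add: fun_eq_iff[of T] fun_eq_iff[of "\<lambda>i. inv \<sigma> ` T i"] *)
  qed
  have "polytabloid lam (\<sigma> \<circ> t) T = (\<Sum>\<pi>\<in>column_stabilizer lam t. of_int (sign (?h \<pi>)) *
      (if T = tabloid lam (?h \<pi> \<circ> (\<sigma> \<circ> t)) then 1 else 0))"
    unfolding polytabloid_def
    by (rule sum.reindex_bij_witness[where i = ?h and j = ?h'])
      (use 1 2 in \<open>auto simp: fun_eq_iff inv1 inv2 comp_def\<close>)
  also have "\<dots> = perm_act \<sigma> (polytabloid lam t) T"
    unfolding perm_act_def polytabloid_def by (intro sum.cong refl) (simp only: sgn tab)
  finally show "perm_act \<sigma> (polytabloid lam t) T = polytabloid lam (\<sigma> \<circ> t) T" by simp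
qed

lemma perm_act_specht:
  assumes \<sigma>: "\<sigma> permutes {..<sum_list lam}" and v: "v \<in> specht lam"
  shows "perm_act \<sigma> v \<in> specht lam"
proof -
  interpret T: Vector_Spaces.linear cscale cscale "perm_act \<sigma>" by (rule linear_perm_act)
  have "\<sigma> \<circ> t \<in> tableaux lam" if "t \<in> tableaux lam" for t
    using that permutes_imp_bij[OF \<sigma>] by (auto simp: tableaux_def intro: bij_betw_trans)
  then have "perm_act \<sigma> ` polytabloid lam ` tableaux lam \<subseteq> polytabloid lam ` tableaux lam"
    using perm_act_polytabloid[OF \<sigma>] by auto
  then have "cfun.span (perm_act \<sigma> ` polytabloid lam ` tableaux lam) \<subseteq> specht lam"
    unfolding specht_def by (rule cfun.span_mono)
  then show ?thesis
    using v by (auto simp: specht_def T.span_image)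
qed

lemma finite_polytabloids: "finite (polytabloid lam ` tableaux lam)"
proof -
  define D where "D = diagram lam"
  have "diagram lam = (SIGMA i:{..<length lam}. {..<lam ! i})"
    by (auto simp: diagram_def)
  then have fin: "finite D" by (simp add: D_def)
  have restr: "polytabloid lam t = polytabloid lam (\<lambda>p. if p \<in> D then t p else 0)" for t
  proof -
    let ?t = "\<lambda>p. if p \<in> D then t p else 0"
    have "col lam t = col lam ?t"
      by (rule ext) (auto simp: col_def D_def intro!: image_cong)
    moreover have "tabloid lam (\<pi> \<circ> t) = tabloid lam (\<pi> \<circ> ?t)" for \<pi>
      by (rule ext) (auto simp: tabloid_def D_def intro!: image_cong)
    ultimately show ?thesis
      unfolding polytabloid_def column_stabilizer_def by simp
  qed
  let ?F = "{f. f ` D \<subseteq> {..<sum_list lam} \<and> {p. f p \<noteq> 0} \<subseteq> D}"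
  have "polytabloid lam ` tableaux lam \<subseteq> polytabloid lam ` ?F"
  proof
    fix x assume "x \<in> polytabloid lam ` tableaux lam"
    then obtain t where t: "t \<in> tableaux lam" "x = polytabloid lam t" by auto
    then have "(\<lambda>p. if p \<in> D then t p else 0) \<in> ?F"
      by (auto simp: tableaux_def bij_betw_def D_def)
    with t restr[of t] show "x \<in> polytabloid lam ` ?F" by blast
  qed
  moreover have "finite ?F"
  proof (rule finite_subset)
    show "?F \<subseteq> {f. \<forall>p. (p \<in> D \<longrightarrow> f p \<in> {..<sum_list lam}) \<and> (p \<notin> D \<longrightarrow> f p = 0)}"
      by auto
    show "finite {f. \<forall>p. (p \<in> D \<longrightarrow> f p \<in> {..<sum_list lam}) \<and> (p \<notin> D \<longrightarrow> f p = 0)}"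
      by (rule finite_set_of_finite_funs) (use fin in auto)
  qed
  ultimately show ?thesis by (meson finite_imageI finite_subset)
qed

lemma specht_char_in_Reals:
  assumes \<sigma>: "\<sigma> permutes {..<sum_list lam}"
  shows "specht_char lam \<sigma> \<in> \<real>"
proof -
  define P where "P = polytabloid lam ` tableaux lam"
  obtain B where B: "B \<subseteq> P" "cfun.independent B" "P \<subseteq> cfun.span B"
    using cfun.maximal_independent_subset[of P] by blast
  have finB: "finite B" using B(1) finite_polytabloids by (auto simp: P_def intro: finite_subset)
  have spanB: "cfun.span B = specht lam"
    using B(1,3) cfun.span_mono[OF B(1)] cfun.span_minimal[OF B(3)] by (auto simp: specht_def P_def)
  have real: "v T \<in> \<real>" if "v \<in> P" for v T
    using that by (auto simp: P_def polytabloid_def intro!: sum_in_Reals)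
  have "cfun.representation B (perm_act \<sigma> b) b \<in> \<real>" if b: "b \<in> B" for b
  proof -
    let ?r = "cfun.representation B (perm_act \<sigma> b)"
    have mem: "perm_act \<sigma> b \<in> cfun.span B"
      using perm_act_specht[OF \<sigma>] b spanB cfun.span_superset by blast
    have nz: "{c. ?r c \<noteq> 0} \<subseteq> B" using cfun.representation_ne_zero by blast
    have "?r = (\<lambda>c. cnj (?r c))"
    proof (rule cfun.representation_eqI[OF B(2) mem])
      show "cnj (?r c) \<noteq> 0 \<Longrightarrow> c \<in> B" for c using nz by auto
      show "finite {c. cnj (?r c) \<noteq> 0}" using nz finB by (auto intro: finite_subset)
      have sum_app: "(\<Sum>c\<in>A. g c) T = (\<Sum>c\<in>A. g c T)"
        for A and g :: "((nat \<Rightarrow> nat set) \<Rightarrow> complex) \<Rightarrow> (nat \<Rightarrow> nat set) \<Rightarrow> complex" and T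
        by (induction A rule: infinite_finite_induct) auto
      have eq: "(\<Sum>c\<in>B. cscale (?r c) c) = perm_act \<sigma> b"
        by (rule cfun.sum_representation_eq[OF B(2) mem finB]) simp
      have "(\<Sum>c | cnj (?r c) \<noteq> 0. cscale (cnj (?r c)) c) = (\<Sum>c\<in>B. cscale (cnj (?r c)) c)"
        by (rule sum.mono_neutral_left) (use finB nz in auto)
      also have "\<dots> = perm_act \<sigma> b"
      proof
        fix T
        have "(\<Sum>c\<in>B. cscale (cnj (?r c)) c) T = (\<Sum>c\<in>B. cnj (?r c * c T))"
          unfolding sum_app cscale_def
          by (intro sum.cong refl) (use real B(1) in \<open>auto simp: Reals_cnj_iff\<close>)
        also have "\<dots> = cnj ((\<Sum>c\<in>B. cscale (?r c) c) T)"
          unfolding sum_app by (simp add: cscale_def)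
        also have "\<dots> = perm_act \<sigma> b T"
          using real[of b] b B(1) unfolding eq by (auto simp: perm_act_def Reals_cnj_iff)
        finally show "(\<Sum>c\<in>B. cscale (cnj (?r c)) c) T = perm_act \<sigma> b T" .
      qed
      finally show "(\<Sum>c | cnj (?r c) \<noteq> 0. cscale (cnj (?r c)) c) = perm_act \<sigma> b" .
    qed
    then have "?r b = cnj (?r b)" by (rule fun_cong)
    then show ?thesis by (simp add: Reals_cnj_iff)
  qed
  moreover have "specht_char lam \<sigma> = (\<Sum>b\<in>B. cfun.representation B (perm_act \<sigma> b) b)"
    unfolding specht_char_def
    by (rule trace_on_eq[OF linear_perm_act perm_act_specht[OF \<sigma>] finB B(2) spanB])
  ultimately show ?thesis by auto
qed

lemma kronecker_in_Reals:
  assumes "lam \<turnstile> n" "mu \<turnstile> n" "nu \<turnstile> n"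
  shows "kronecker n lam mu nu \<in> \<real>"
proof -
  have "specht_char lam \<sigma> * specht_char mu \<sigma> * specht_char nu \<sigma> \<in> \<real>" if "\<sigma> permutes {..<n}" for \<sigma>
    using that assms by (auto simp: is_partition_def intro!: Reals_mult specht_char_in_Reals)
  moreover have "(fact n :: complex) \<in> \<real>"
    by (metis Reals_of_nat of_nat_fact)
  ultimately show ?thesis
    unfolding kronecker_def by (auto intro!: Reals_divide sum_in_Reals)
qed

end

theory Submission
  imports Defs "HOL-Combinatorics.Orbits"
begin

text \<open>
  Let \<open>\<psi>\<^sub>d(\<sigma>)\<close> be the number of words of length \<open>n\<close> over \<open>d\<close> letters that are fixed by \<open>\<sigma>\<close>; this
  is the character of \<open>S\<^sub>n\<close> on the \<open>n\<close>-th tensor power of a space of dimension \<open>d\<close>. Write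
  \<open>\<psi>\<^sub>k = (\<Sum>\<lambda>. m\<^sub>\<lambda> * \<chi>\<^sup>\<lambda>)\<close>. The coefficients \<open>m\<^sub>\<lambda>\<close> are nonnegative, and \<open>m\<^sub>\<lambda> = 0\<close> if \<open>\<lambda>\<close> has more than
  \<open>k\<close> rows: a word over \<open>k\<close> letters repeats a letter within the first column, so it is killed by
  antisymmetrising over that column. A triple of words is a word over triples of letters, so
  \<open>\<psi>\<^sub>k\<^sup>3\<close> is \<open>\<psi>\<^sub>d\<close> with \<open>d = k\<^sup>3\<close>. Averaging over \<open>S\<^sub>n\<close> and counting orbits of words by their contents gives
  \<open>(n + k\<^sup>3 - 1 choose n) = (\<Sum>\<lambda> \<mu> \<nu>. m\<^sub>\<lambda> * m\<^sub>\<mu> * m\<^sub>\<nu> * g(\<lambda>,\<mu>,\<nu>)) \<le> (\<Sum>\<lambda>. m\<^sub>\<lambda>)\<^sup>3 * A(n,k)\<close>.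
  In the same way \<open>\<psi>\<^sub>k\<^sup>2\<close> gives \<open>(\<Sum>\<lambda>. m\<^sub>\<lambda>\<^sup>2) = (n + k\<^sup>2 - 1 choose n)\<close>, whence \<open>(\<Sum>\<lambda>. m\<^sub>\<lambda>)\<close> is at most
  \<open>(\<Sum>\<lambda>. 1 + m\<^sub>\<lambda>\<^sup>2)\<close>, which is at most \<open>2 * (n + 1) ^ (k\<^sup>2 - 1)\<close>.
  The binomial coefficient \<open>(n + k\<^sup>3 - 1 choose n)\<close> grows like \<open>n ^ (k\<^sup>3 - 1)\<close>, so
  \<open>A(n,k)\<close> grows at least like \<open>n\<close> to the power \<open>(k\<^sup>3 - 1) - 3 * (k\<^sup>2 - 1) = k\<^sup>3 - 3 * k\<^sup>2 + 2\<close>, and this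
  exponent exceeds the one in the theorem by \<open>3 * k - 1\<close>. The two counts are
  \<open>contingency_le_kronecker\<close> and \<open>sum_word_mult_sq\<close>.

  This needs the Specht characters to be an orthonormal basis of the class functions. Fix a tableau
  with row stabiliser \<open>R\<close>, column stabiliser \<open>C\<close> and polytabloid \<open>e\<close>. Everything about its Specht
  module is encoded in the matrix coefficient \<open>p \<mapsto> \<langle>p e, e\<rangle>\<close>, a signed count of
  the pairs \<open>(\<pi>, \<rho>)\<close> in \<open>C \<times> C\<close> with \<open>\<pi> p \<rho>\<close> in \<open>R\<close>. Young's lemma says that antisymmetrising a translate of \<open>e\<close> over \<open>C\<close> returns a multiple of
  \<open>e\<close>; it turns into a convolution identity (\<open>coef_conv\<close>) that takes the place of Schur's lemma, and
  into an explicit frame for the Specht module, from which its character is read off as the average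
  of the matrix coefficient over a conjugacy class, up to a constant (\<open>specht_char_young\<close>).
  Orthogonality for different shapes follows from the dominance order (\<open>filling_chi_orthogonal\<close>). The characters span because there
  are at most as many conjugacy classes as partitions of \<open>n\<close>: a permutation is determined up to
  conjugation by a tableau whose rows are its cycles (\<open>class_function_expansion\<close>).
\<close>

section \<open>Sums over groups of permutations\<close>

abbreviation perms :: "nat \<Rightarrow> (nat \<Rightarrow> nat) set" where
  "perms n \<equiv> {p. p permutes {..<n}}"

definition perm_group :: "nat \<Rightarrow> (nat \<Rightarrow> nat) set \<Rightarrow> bool" where
  "perm_group n H \<longleftrightarrow> H \<subseteq> perms n \<and> id \<in> H \<and> (\<forall>p\<in>H. \<forall>q\<in>H. p \<circ> q \<in> H) \<and> (\<forall>p\<in>H. inv p \<in> H)"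

lemma perm_group_perms: "perm_group n (perms n)"
  by (auto simp: perm_group_def permutes_compose permutes_inv permutes_id)

lemma finite_perms: "finite (perms n)"
  by (simp add: finite_permutations)

lemma perm_group_finite: "perm_group n H \<Longrightarrow> finite H"
  using finite_perms finite_subset unfolding perm_group_def by blast

lemma perm_groupD:
  assumes "perm_group n H"
  shows "p \<in> H \<Longrightarrow> p permutes {..<n}" "id \<in> H" "p \<in> H \<Longrightarrow> q \<in> H \<Longrightarrow> p \<circ> q \<in> H"
    "p \<in> H \<Longrightarrow> inv p \<in> H"
  using assms by (auto simp: perm_group_def)

lemma perm_inv_cancel:
  assumes "p permutes S"
  shows "inv p \<circ> p = id" "p \<circ> inv p = id" "inv p \<circ> (p \<circ> q) = q" "p \<circ> (inv p \<circ> q) = q"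
    "inv (inv p) = p"
  using permutes_inv_o[OF assms] permutes_inv_inv[OF assms] by (simp_all add: o_assoc)

lemma perm_inv_comp: "p permutes S \<Longrightarrow> q permutes S \<Longrightarrow> inv (p \<circ> q) = inv q \<circ> inv p"
  by (simp add: o_inv_distrib permutes_bij)

lemma sum_group_left:
  assumes H: "perm_group n H" and g: "g \<in> H"
  shows "(\<Sum>x\<in>H. f (g \<circ> x)) = (\<Sum>x\<in>H. f x)"
  by (rule sum.reindex_bij_witness[where i = "\<lambda>x. inv g \<circ> x" and j = "\<lambda>x. g \<circ> x"])
    (use g in \<open>auto simp: perm_inv_cancel[OF perm_groupD(1)[OF H g]] intro: perm_groupD[OF H]\<close>)

lemma sum_group_right:
  assumes H: "perm_group n H" and g: "g \<in> H"
  shows "(\<Sum>x\<in>H. f (x \<circ> g)) = (\<Sum>x\<in>H. f x)"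
  by (rule sum.reindex_bij_witness[where i = "\<lambda>x. x \<circ> inv g" and j = "\<lambda>x. x \<circ> g"])
    (use g in \<open>auto simp: o_assoc[symmetric] perm_inv_cancel[OF perm_groupD(1)[OF H g]] intro: perm_groupD[OF H]\<close>)

lemma sum_group_inv:
  assumes H: "perm_group n H"
  shows "(\<Sum>x\<in>H. f (inv x)) = (\<Sum>x\<in>H. f x)"
  by (rule sum.reindex_bij_witness[where i = inv and j = inv])
    (auto simp: perm_inv_cancel(5)[OF perm_groupD(1)[OF H]] intro: perm_groupD[OF H])

definition rsign :: "(nat \<Rightarrow> nat) \<Rightarrow> real" where "rsign p = of_int (sign p)"

lemma rsign_compose: "p permutes {..<n} \<Longrightarrow> q permutes {..<n} \<Longrightarrow> rsign (p \<circ> q) = rsign p * rsign q"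
  unfolding rsign_def by (metis sign_compose permutes_imp_permutation finite_lessThan of_int_mult)

lemma rsign_inv: "p permutes {..<n} \<Longrightarrow> rsign (inv p) = rsign p"
  unfolding rsign_def by (metis sign_inverse permutes_imp_permutation finite_lessThan)

lemma rsign_sq [simp]: "rsign p * rsign p = 1" "rsign p * (rsign p * x) = x"
  unfolding rsign_def by (metis of_int_mult sign_idempotent of_int_1, metis of_int_mult sign_idempotent of_int_1 mult.assoc mult_1)

lemma rsign_id [simp]: "rsign id = 1"
  by (simp add: rsign_def)

section \<open>Young symmetrizers and their characters\<close>

text \<open>\<open>R\<close> and \<open>C\<close> stand for the row and the column stabiliser of a tableau. In the comments below, \<open>T\<close> is
  the tabloid and \<open>e\<close> the polytabloid of this tableau, so that the tabloids \<open>p T\<close> correspond to the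
  cosets \<open>p R\<close>.\<close>
locale young_base =
  fixes n :: nat and R C :: "(nat \<Rightarrow> nat) set"
  assumes R: "perm_group n R" and C: "perm_group n C" and RC: "R \<inter> C = {id}"
begin

text \<open>The coefficient of \<open>T\<close> in the polytabloid \<open>p e\<close>. More generally the coefficient of \<open>w T\<close> in \<open>p e\<close>
  is \<open>eps (inv w \<circ> p)\<close>.\<close>
definition eps :: "(nat \<Rightarrow> nat) \<Rightarrow> real" where
  "eps p = (\<Sum>\<pi>\<in>C. rsign \<pi> * of_bool (p \<circ> \<pi> \<in> R))"

text \<open>The inner product of \<open>p e\<close> and \<open>e\<close> in the space of tabloids, where the tabloids are an orthonormal
  basis.\<close>
definition coef :: "(nat \<Rightarrow> nat) \<Rightarrow> real" where
  "coef p = (\<Sum>\<pi>\<in>C. rsign \<pi> * eps (\<pi> \<circ> p))"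

lemmas S = perm_group_perms[of n]

lemma CS: "\<pi> \<in> C \<Longrightarrow> \<pi> permutes {..<n}" and RS: "r \<in> R \<Longrightarrow> r permutes {..<n}"
  using perm_groupD(1) R C by blast+

lemma C_fin: "finite C" and R_fin: "finite R"
  using perm_group_finite R C by blast+

lemma C_pos: "card C > 0"
  using C_fin perm_groupD(2)[OF C] by (auto simp: card_gt_0_iff)

lemma eps_id: "eps id = 1"
proof -
  have "eps id = (\<Sum>\<pi>\<in>{id}. rsign \<pi> * of_bool (id \<circ> \<pi> \<in> R))"
    unfolding eps_def
    by (rule sum.mono_neutral_right) (use C_fin perm_groupD(2)[OF C] RC in auto)
  then show ?thesis using perm_groupD(2)[OF R] by simp
qed

lemma R_inv_iff: "p permutes {..<n} \<Longrightarrow> inv p \<in> R \<longleftrightarrow> p \<in> R"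
  using perm_groupD(4)[OF R] perm_inv_cancel(5) by metis

lemma eps_R: assumes "r \<in> R" "p permutes {..<n}" shows "eps (r \<circ> p) = eps p"
proof -
  have "r \<circ> q \<in> R \<longleftrightarrow> q \<in> R" for q
    using perm_groupD(3,4)[OF R] assms(1) perm_inv_cancel(3)[OF RS[OF assms(1)]] by metis
  then show ?thesis by (simp add: eps_def o_assoc[symmetric])
qed

lemma eps_C: assumes "\<pi> \<in> C" "p permutes {..<n}" shows "eps (p \<circ> \<pi>) = rsign \<pi> * eps p"
proof -
  have "eps (p \<circ> \<pi>) = (\<Sum>q\<in>C. rsign \<pi> * (rsign (\<pi> \<circ> q) * of_bool (p \<circ> (\<pi> \<circ> q) \<in> R)))"
    unfolding eps_def o_assoc by (intro sum.cong refl) (simp add: rsign_compose[of _ n] CS assms)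
  also have "\<dots> = rsign \<pi> * eps p"
    unfolding eps_def sum_distrib_left by (rule sum_group_left[OF C assms(1)])
  finally show ?thesis .
qed

lemma eps_inv:
  assumes p: "p permutes {..<n}"
  shows "eps (inv p) = (\<Sum>\<pi>\<in>C. rsign \<pi> * of_bool (\<pi> \<circ> p \<in> R))"
proof -
  have "eps (inv p) = (\<Sum>\<pi>\<in>C. rsign (inv \<pi>) * of_bool (inv p \<circ> inv \<pi> \<in> R))"
    unfolding eps_def by (rule sum_group_inv[OF C, symmetric])
  also have "\<dots> = (\<Sum>\<pi>\<in>C. rsign \<pi> * of_bool (\<pi> \<circ> p \<in> R))"
  proof (intro sum.cong refl)
    fix \<pi> assume "\<pi> \<in> C"
    then have "\<pi> permutes {..<n}" by (rule CS)
    then show "rsign (inv \<pi>) * of_bool (inv p \<circ> inv \<pi> \<in> R) = rsign \<pi> * of_bool (\<pi> \<circ> p \<in> R)"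
      using R_inv_iff[of "\<pi> \<circ> p"] p by (simp add: rsign_inv perm_inv_comp permutes_compose)
  qed
  finally show ?thesis .
qed

text \<open>Symmetrising on the right instead of the left: the double sum over \<open>C \<times> C\<close> behind \<open>coef\<close> is
  taken in the other order.\<close>
lemma coef_altdef:
  assumes p: "p permutes {..<n}"
  shows "coef p = (\<Sum>\<pi>\<in>C. rsign \<pi> * eps (inv (p \<circ> \<pi>)))"
proof -
  have "coef p = (\<Sum>\<pi>'\<in>C. \<Sum>\<pi>\<in>C. rsign \<pi> * (rsign \<pi>' * of_bool (\<pi> \<circ> (p \<circ> \<pi>') \<in> R)))"
    unfolding coef_def eps_def sum_distrib_left o_assoc by (subst sum.swap) (rule refl)
  also have "\<dots> = (\<Sum>\<pi>\<in>C. rsign \<pi> * eps (inv (p \<circ> \<pi>)))"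
    by (intro sum.cong refl, subst eps_inv)
      (auto simp: sum_distrib_left p CS permutes_compose mult_ac)
  finally show ?thesis .
qed

lemma coef_inv: assumes p: "p permutes {..<n}" shows "coef (inv p) = coef p"
proof -
  have "coef p = (\<Sum>\<pi>\<in>C. rsign (inv \<pi>) * eps (inv (p \<circ> inv \<pi>)))"
    unfolding coef_altdef[OF p] by (rule sum_group_inv[OF C, symmetric])
  also have "\<dots> = coef (inv p)"
    unfolding coef_def by (intro sum.cong refl)
      (simp add: perm_inv_comp[of _ "{..<n}"] permutes_inv CS p rsign_inv[of _ n] perm_inv_cancel(5)[of _ "{..<n}"])
  finally show ?thesis ..
qed

lemma coef_left: assumes "\<pi> \<in> C" "p permutes {..<n}" shows "coef (\<pi> \<circ> p) = rsign \<pi> * coef p"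
proof -
  have "coef (\<pi> \<circ> p) = (\<Sum>q\<in>C. rsign \<pi> * (rsign (q \<circ> \<pi>) * eps (q \<circ> \<pi> \<circ> p)))"
    unfolding coef_def by (intro sum.cong refl)
     (simp add: rsign_compose[of _ n] CS assms mult_ac o_assoc)
  also have "\<dots> = rsign \<pi> * coef p"
    unfolding coef_def sum_distrib_left by (rule sum_group_right[OF C assms(1)])
  finally show ?thesis .
qed

lemma coef_right: assumes "\<pi> \<in> C" "p permutes {..<n}" shows "coef (p \<circ> \<pi>) = rsign \<pi> * coef p"
proof -
  have "coef (p \<circ> \<pi>) = coef (inv \<pi> \<circ> inv p)"
    using assms CS by (metis coef_inv permutes_compose perm_inv_comp)
  also have "\<dots> = rsign \<pi> * coef p"
    using assms by (simp add: coef_left perm_groupD(4)[OF C] permutes_inv coef_inv rsign_inv[of _ n] CS)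
  finally show ?thesis .
qed

lemma coef_id: "coef id = card C"
proof -
  have "rsign \<pi> * eps (\<pi> \<circ> id) = 1" if "\<pi> \<in> C" for \<pi>
    using eps_C[OF that permutes_id] by (simp add: eps_id)
  then show ?thesis unfolding coef_def by simp
qed

text \<open>The sum over \<open>w\<close> runs through every tabloid \<open>card R\<close> times, so both sides are \<open>card R\<close> times the inner
  product of \<open>p e\<close> and \<open>q e\<close>.\<close>
lemma coef_gram:
  assumes p: "p permutes {..<n}" and q: "q permutes {..<n}"
  shows "(\<Sum>w\<in>perms n. eps (w \<circ> p) * eps (w \<circ> q)) = card R * coef (inv q \<circ> p)"
proof -
  have ind: "(\<Sum>w\<in>perms n. eps (w \<circ> p) * of_bool (w \<circ> u \<in> R)) = card R * eps (inv u \<circ> p)"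
    if u: "u permutes {..<n}" for u
  proof -
    have "(\<Sum>w\<in>perms n. eps (w \<circ> p) * of_bool (w \<circ> u \<in> R)) =
       (\<Sum>w\<in>perms n. eps (w \<circ> inv u \<circ> p) * of_bool (w \<circ> inv u \<circ> u \<in> R))"
      by (rule sum_group_right[OF S, symmetric]) (use u in \<open>simp add: permutes_inv\<close>)
    also have "\<dots> = (\<Sum>w\<in>perms n. eps (w \<circ> (inv u \<circ> p)) * of_bool (w \<in> R))"
      by (simp add: o_assoc[symmetric] perm_inv_cancel[OF u])
    also have "\<dots> = (\<Sum>w\<in>R. eps (w \<circ> (inv u \<circ> p)) * of_bool (w \<in> R))"
      by (rule sum.mono_neutral_right) (auto simp: finite_perms RS)
    also have "\<dots> = (\<Sum>w\<in>R. eps (inv u \<circ> p))"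
      by (intro sum.cong refl) (simp add: eps_R permutes_compose p u permutes_inv)
    finally show ?thesis by simp
  qed
  have "(\<Sum>w\<in>perms n. eps (w \<circ> p) * eps (w \<circ> q)) =
      (\<Sum>\<pi>\<in>C. rsign \<pi> * (\<Sum>w\<in>perms n. eps (w \<circ> p) * of_bool (w \<circ> (q \<circ> \<pi>) \<in> R)))"
    unfolding eps_def[of "_ \<circ> q"] sum_distrib_left
    by (subst sum.swap) (simp add: mult_ac o_assoc)
  also have "\<dots> = (\<Sum>\<pi>\<in>C. rsign \<pi> * (card R * eps (inv \<pi> \<circ> (inv q \<circ> p))))"
    by (intro sum.cong refl, subst ind)
      (simp_all add: q CS permutes_compose perm_inv_comp[of _ "{..<n}"] o_assoc[symmetric])
  also have "\<dots> = (\<Sum>\<pi>\<in>C. rsign (inv \<pi>) * (card R * eps (inv (inv \<pi>) \<circ> (inv q \<circ> p))))"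
    by (rule sum_group_inv[OF C, symmetric])
  also have "\<dots> = card R * coef (inv q \<circ> p)"
    unfolding coef_def sum_distrib_left
    by (intro sum.cong refl) (simp add: rsign_inv[of _ n] CS perm_inv_cancel(5)[of _ "{..<n}"])
  finally show ?thesis .
qed

text \<open>Up to a positive factor this is the squared norm of the sum of \<open>p e\<close> over \<open>p \<in> G\<close>, so the trivial
  character of \<open>G\<close> occurs in the Specht module with nonnegative multiplicity.\<close>
lemma sum_coef_subgroup_nonneg:
  assumes G: "perm_group n G"
  shows "(\<Sum>p\<in>G. coef p) \<ge> 0"
proof -
  have GS: "p \<in> G \<Longrightarrow> p permutes {..<n}" for p using perm_groupD(1)[OF G] .
  have "card R * (card G * (\<Sum>p\<in>G. coef p)) = (\<Sum>q\<in>G. card R * (\<Sum>p\<in>G. coef (inv q \<circ> p)))"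
    by (simp add: sum_group_left[OF G perm_groupD(4)[OF G], of _ coef])
  also have "\<dots> = (\<Sum>q\<in>G. \<Sum>p\<in>G. \<Sum>w\<in>perms n. eps (w \<circ> p) * eps (w \<circ> q))"
    by (simp add: sum_distrib_left coef_gram GS)
  also have "\<dots> = (\<Sum>q\<in>G. \<Sum>w\<in>perms n. \<Sum>p\<in>G. eps (w \<circ> p) * eps (w \<circ> q))"
    by (rule sum.cong[OF refl], rule sum.swap)
  also have "\<dots> = (\<Sum>w\<in>perms n. \<Sum>q\<in>G. \<Sum>p\<in>G. eps (w \<circ> p) * eps (w \<circ> q))"
    by (rule sum.swap)
  also have "\<dots> = (\<Sum>w\<in>perms n. (\<Sum>p\<in>G. eps (w \<circ> p))\<^sup>2)"
    by (simp add: power2_eq_square sum_product mult.commute)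
  also have "\<dots> \<ge> 0" by (intro sum_nonneg) simp
  finally have "0 \<le> card R * (card G * (\<Sum>p\<in>G. coef p))" .
  moreover have "card R > 0" "card G > 0"
    using R_fin perm_group_finite[OF G] perm_groupD(2)[OF G] perm_groupD(2)[OF R]
    by (auto simp: card_gt_0_iff)
  ultimately show ?thesis by (simp add: zero_le_mult_iff)
qed

end

text \<open>Young's lemma, read off on the coefficient of \<open>inv w T\<close>: antisymmetrising the tabloid \<open>p T\<close> over \<open>C\<close>
  gives a multiple of \<open>e\<close>.\<close>
locale young = young_base +
  assumes young: "\<And>w p. w permutes {..<n} \<Longrightarrow> p permutes {..<n} \<Longrightarrow>
    (\<Sum>\<pi>\<in>C. rsign \<pi> * of_bool (w \<circ> \<pi> \<circ> p \<in> R)) = eps w * eps (inv p)"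
begin

text \<open>The same for polytabloids: antisymmetrising \<open>p e\<close> over \<open>C\<close> gives \<open>\<langle>p e, e\<rangle> e\<close>.\<close>
lemma eps_sandwich:
  assumes w: "w permutes {..<n}" and p: "p permutes {..<n}"
  shows "(\<Sum>\<pi>\<in>C. rsign \<pi> * eps (w \<circ> \<pi> \<circ> p)) = eps w * coef p"
proof -
  have "(\<Sum>\<pi>\<in>C. rsign \<pi> * eps (w \<circ> \<pi> \<circ> p)) =
     (\<Sum>q\<in>C. rsign q * (\<Sum>\<pi>\<in>C. rsign \<pi> * of_bool (w \<circ> \<pi> \<circ> (p \<circ> q) \<in> R)))"
    unfolding eps_def sum_distrib_left by (subst sum.swap) (simp add: o_assoc mult_ac)
  also have "\<dots> = (\<Sum>q\<in>C. rsign q * (eps w * eps (inv (p \<circ> q))))"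
    by (intro sum.cong refl) (simp add: young w p CS permutes_compose)
  also have "\<dots> = eps w * coef p"
    by (simp add: coef_altdef[OF p] sum_distrib_left mult_ac)
  finally show ?thesis .
qed

lemma coef_sandwich:
  assumes w: "w permutes {..<n}" and p: "p permutes {..<n}"
  shows "(\<Sum>\<pi>\<in>C. rsign \<pi> * coef (w \<circ> \<pi> \<circ> p)) = coef w * coef p"
proof -
  have "(\<Sum>\<pi>\<in>C. rsign \<pi> * coef (w \<circ> \<pi> \<circ> p)) =
     (\<Sum>q\<in>C. rsign q * (\<Sum>\<pi>\<in>C. rsign \<pi> * eps (q \<circ> w \<circ> \<pi> \<circ> p)))"
    unfolding coef_def sum_distrib_left by (subst sum.swap) (simp add: o_assoc mult_ac)
  also have "\<dots> = coef w * coef p"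
    by (simp add: eps_sandwich w p CS permutes_compose coef_def[of w] sum_distrib_right mult.assoc)
  finally show ?thesis .
qed

text \<open>The scalar by which the frame operator \<open>v \<mapsto> (\<Sum>p. \<langle>v, p e\<rangle> p e)\<close> acts on the Specht module, see
  \<open>eps_reproducing\<close>.\<close>
definition norm_const :: real where "norm_const = (\<Sum>p\<in>perms n. (coef p)\<^sup>2) / card C"

lemma norm_const_card: "norm_const * card C = (\<Sum>p\<in>perms n. coef p * coef p)"
  using C_pos by (simp add: norm_const_def power2_eq_square)

lemma norm_const_pos: "norm_const > 0"
proof -
  have "0 < (coef id)\<^sup>2" using C_pos by (simp add: coef_id)
  also have "\<dots> \<le> (\<Sum>p\<in>perms n. (coef p)\<^sup>2)"
    using member_le_sum[of id "perms n" "\<lambda>p. (coef p)\<^sup>2"] by (simp add: finite_perms)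
  finally show ?thesis using C_pos by (simp add: norm_const_def)
qed

text \<open>This is Schur orthogonality of matrix coefficients. Both arguments can be pulled out because the
  coefficient function changes only by signs under \<open>C\<close> on either side: replacing \<open>p\<close> by
  \<open>\<pi> \<circ> p \<circ> \<rho>\<close> and averaging over \<open>\<pi>\<close> and \<open>\<rho>\<close> in \<open>C\<close> allows \<open>coef_sandwich\<close> to be applied twice to the
  second factor.\<close>
lemma coef_conv:
  assumes x: "x permutes {..<n}" and q: "q permutes {..<n}"
  shows "(\<Sum>p\<in>perms n. coef p * coef (x \<circ> p \<circ> q)) = norm_const / card C * coef x * coef q"
proof -
  have "(\<Sum>p\<in>perms n. coef p * coef (x \<circ> p \<circ> q)) =
     (\<Sum>p\<in>perms n. coef p * (rsign \<pi> * (rsign \<rho> * coef (x \<circ> \<pi> \<circ> p \<circ> \<rho> \<circ> q))))"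
    if \<pi>: "\<pi> \<in> C" and \<rho>: "\<rho> \<in> C" for \<pi> \<rho>
  proof -
    have "(\<Sum>p\<in>perms n. coef p * coef (x \<circ> p \<circ> q)) =
      (\<Sum>p\<in>perms n. coef (\<pi> \<circ> p) * coef (x \<circ> (\<pi> \<circ> p) \<circ> q))"
      by (rule sum_group_left[OF S, symmetric]) (use \<pi> CS in auto)
    also have "\<dots> = (\<Sum>p\<in>perms n. coef (\<pi> \<circ> (p \<circ> \<rho>)) * coef (x \<circ> (\<pi> \<circ> (p \<circ> \<rho>)) \<circ> q))"
      by (rule sum_group_right[OF S, symmetric]) (use \<rho> CS in auto)
    also have "\<dots> = (\<Sum>p\<in>perms n. coef p * (rsign \<pi> * (rsign \<rho> * coef (x \<circ> \<pi> \<circ> p \<circ> \<rho> \<circ> q))))"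
      by (intro sum.cong refl)
       (use \<pi> \<rho> CS in \<open>simp add: coef_left coef_right permutes_compose mult_ac o_assoc\<close>)
    finally show ?thesis .
  qed
  then have "real (card C) * (card C * (\<Sum>p\<in>perms n. coef p * coef (x \<circ> p \<circ> q))) =
     (\<Sum>\<pi>\<in>C. \<Sum>\<rho>\<in>C. \<Sum>p\<in>perms n. coef p * (rsign \<pi> * (rsign \<rho> * coef (x \<circ> \<pi> \<circ> p \<circ> \<rho> \<circ> q))))"
    by (metis (no_types, lifting) sum_constant sum.cong)
  also have "\<dots> = (\<Sum>p\<in>perms n. coef p * (\<Sum>\<pi>\<in>C. rsign \<pi> * (\<Sum>\<rho>\<in>C. rsign \<rho> * coef (x \<circ> \<pi> \<circ> p \<circ> \<rho> \<circ> q))))"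
    unfolding sum_distrib_left
    by (rule trans[OF sum.cong[OF refl sum.swap] sum.swap])
  also have "\<dots> = (\<Sum>p\<in>perms n. coef p * (coef x * coef p * coef q))"
  proof (intro sum.cong refl arg_cong2[where f = "(*)"])
    fix p assume "p \<in> perms n"
    then have p: "p permutes {..<n}" by simp
    have "(\<Sum>\<pi>\<in>C. rsign \<pi> * (\<Sum>\<rho>\<in>C. rsign \<rho> * coef (x \<circ> \<pi> \<circ> p \<circ> \<rho> \<circ> q))) =
      (\<Sum>\<pi>\<in>C. rsign \<pi> * (coef (x \<circ> \<pi> \<circ> p) * coef q))"
      by (intro sum.cong refl) (simp add: coef_sandwich x p q CS permutes_compose)
    also have "\<dots> = coef x * coef p * coef q"
      unfolding coef_sandwich[OF x p, symmetric] sum_distrib_right by (simp add: mult.assoc)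
    finally show "(\<Sum>\<pi>\<in>C. rsign \<pi> * (\<Sum>\<rho>\<in>C. rsign \<rho> * coef (x \<circ> \<pi> \<circ> p \<circ> \<rho> \<circ> q))) = coef x * coef p * coef q" .
  qed
  also have "\<dots> = (norm_const * card C) * coef x * coef q"
    unfolding norm_const_card sum_distrib_right sum_distrib_left by (simp add: mult_ac)
  finally show ?thesis using C_pos by (simp add: field_simps)
qed

text \<open>The frame \<open>p e\<close> is tight: \<open>(\<Sum>p. \<langle>q e, p e\<rangle> p e)\<close> is \<open>norm_const\<close> times \<open>q e\<close>.\<close>
lemma eps_reproducing:
  assumes w: "w permutes {..<n}" and q: "q permutes {..<n}"
  shows "(\<Sum>p\<in>perms n. eps (w \<circ> p) * coef (inv p \<circ> q)) = norm_const * eps (w \<circ> q)"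
proof -
  have "(\<Sum>p\<in>perms n. eps (w \<circ> p) * coef (inv p \<circ> q)) =
     (\<Sum>p\<in>perms n. coef p * (rsign \<pi> * eps (w \<circ> q \<circ> \<pi> \<circ> p)))"
    if \<pi>: "\<pi> \<in> C" for \<pi>
  proof -
    have "(\<Sum>p\<in>perms n. eps (w \<circ> p) * coef (inv p \<circ> q)) =
      (\<Sum>p\<in>perms n. eps (w \<circ> (q \<circ> \<pi> \<circ> p)) * coef (inv (q \<circ> \<pi> \<circ> p) \<circ> q))"
      by (rule sum_group_left[OF S, symmetric]) (use \<pi> CS q in \<open>auto simp: permutes_compose\<close>)
    also have "\<dots> = (\<Sum>p\<in>perms n. coef p * (rsign \<pi> * eps (w \<circ> q \<circ> \<pi> \<circ> p)))"
    proof (intro sum.cong refl)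
      fix p assume "p \<in> perms n"
      then have p: "p permutes {..<n}" by simp
      have "inv (q \<circ> \<pi> \<circ> p) \<circ> q = inv p \<circ> inv \<pi>"
        using p q CS[OF \<pi>]
        by (simp add: perm_inv_comp[of _ "{..<n}"] permutes_compose o_assoc[symmetric] perm_inv_cancel[OF q])
      moreover have "coef (inv p \<circ> inv \<pi>) = rsign \<pi> * coef p"
        using \<pi> p by (simp add: coef_right perm_groupD(4)[OF C] permutes_inv coef_inv rsign_inv[of _ n] CS)
      ultimately show "eps (w \<circ> (q \<circ> \<pi> \<circ> p)) * coef (inv (q \<circ> \<pi> \<circ> p) \<circ> q) = coef p * (rsign \<pi> * eps (w \<circ> q \<circ> \<pi> \<circ> p))"
        by (simp add: mult_ac o_assoc)
    qed
    finally show ?thesis .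
  qed
  then have "card C * (\<Sum>p\<in>perms n. eps (w \<circ> p) * coef (inv p \<circ> q)) =
     (\<Sum>\<pi>\<in>C. \<Sum>p\<in>perms n. coef p * (rsign \<pi> * eps (w \<circ> q \<circ> \<pi> \<circ> p)))"
    by (metis (no_types, lifting) sum_constant sum.cong)
  also have "\<dots> = (\<Sum>p\<in>perms n. coef p * (\<Sum>\<pi>\<in>C. rsign \<pi> * eps (w \<circ> q \<circ> \<pi> \<circ> p)))"
    unfolding sum_distrib_left by (rule sum.swap)
  also have "\<dots> = (\<Sum>p\<in>perms n. coef p * (eps (w \<circ> q) * coef p))"
    by (intro sum.cong refl) (simp add: eps_sandwich w q permutes_compose)
  also have "\<dots> = (norm_const * card C) * eps (w \<circ> q)"
    unfolding norm_const_card sum_distrib_right sum_distrib_left by (simp add: mult_ac)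
  finally show ?thesis using C_pos by (simp add: field_simps)
qed

text \<open>The trace of \<open>p\<close> on the Specht module, computed in the tight frame \<open>q e\<close>.\<close>
definition chi :: "(nat \<Rightarrow> nat) \<Rightarrow> real" where
  "chi p = (\<Sum>q\<in>perms n. coef (inv q \<circ> p \<circ> q)) / norm_const"

lemma chi_class:
  assumes p: "p permutes {..<n}" and g: "g permutes {..<n}"
  shows "chi (inv g \<circ> p \<circ> g) = chi p"
proof -
  have "(\<Sum>q\<in>perms n. coef (inv q \<circ> (inv g \<circ> p \<circ> g) \<circ> q)) =
    (\<Sum>q\<in>perms n. coef (inv (g \<circ> q) \<circ> p \<circ> (g \<circ> q)))"
    by (intro sum.cong refl) (use g in \<open>simp add: perm_inv_comp[of _ "{..<n}"] o_assoc\<close>)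
  also have "\<dots> = (\<Sum>q\<in>perms n. coef (inv q \<circ> p \<circ> q))"
    by (rule sum_group_left[OF S]) (use g in simp)
  finally show ?thesis by (simp add: chi_def)
qed

lemma sum_chi_class_fun:
  assumes f: "\<And>p g. p permutes {..<n} \<Longrightarrow> g permutes {..<n} \<Longrightarrow> f (inv g \<circ> p \<circ> g) = f p"
  shows "(\<Sum>p\<in>perms n. chi p * f p) = fact n / norm_const * (\<Sum>p\<in>perms n. coef p * f p)"
proof -
  have "(\<Sum>p\<in>perms n. coef (inv q \<circ> p \<circ> q) * f p) = (\<Sum>p\<in>perms n. coef p * f p)" if "q \<in> perms n" for q
  proof -
    have q: "q permutes {..<n}" using that by simp
    have "(\<Sum>p\<in>perms n. coef (inv q \<circ> p \<circ> q) * f p) = (\<Sum>p\<in>perms n. coef (inv q \<circ> p \<circ> q) * f (inv q \<circ> p \<circ> q))"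
      by (intro sum.cong refl) (simp add: f q)
    also have "\<dots> = (\<Sum>p\<in>perms n. coef (inv q \<circ> p) * f (inv q \<circ> p))"
      unfolding o_assoc[symmetric] by (rule sum_group_right[OF S, where f = "\<lambda>z. coef (inv q \<circ> z) * f (inv q \<circ> z)"]) (use q in simp)
    also have "\<dots> = (\<Sum>p\<in>perms n. coef p * f p)"
      by (rule sum_group_left[OF S]) (use q in \<open>simp add: permutes_inv\<close>)
    finally show ?thesis .
  qed
  then have "(\<Sum>q\<in>perms n. \<Sum>p\<in>perms n. coef (inv q \<circ> p \<circ> q) * f p) = fact n * (\<Sum>p\<in>perms n. coef p * f p)"
    by (simp add: card_permutations[OF refl])
  moreover have "(\<Sum>p\<in>perms n. chi p * f p) = (\<Sum>q\<in>perms n. \<Sum>p\<in>perms n. coef (inv q \<circ> p \<circ> q) * f p) / norm_const"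
    unfolding chi_def by (subst sum.swap) (simp add: sum_divide_distrib sum_distrib_right)
  ultimately show ?thesis by simp
qed

lemma chi_norm: "(\<Sum>p\<in>perms n. chi p * chi p) = fact n"
proof -
  have sq: "(\<Sum>q\<in>perms n. coef q * coef q) = norm_const * card C"
    by (simp add: norm_const_card)
  have "(\<Sum>p\<in>perms n. coef p * chi p) = (\<Sum>q\<in>perms n. \<Sum>p\<in>perms n. coef p * coef (inv q \<circ> p \<circ> q)) / norm_const"
    unfolding chi_def by (subst sum.swap) (simp add: sum_divide_distrib sum_distrib_left)
  also have "\<dots> = (\<Sum>q\<in>perms n. norm_const / card C * (coef q * coef q)) / norm_const"
    by (intro arg_cong2[where f = "(/)"] sum.cong refl) (simp add: coef_conv permutes_inv coef_inv)
  also have "\<dots> = norm_const"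
    unfolding sum_distrib_left[symmetric] sq using norm_const_pos C_pos by simp
  finally show ?thesis
    using norm_const_pos by (simp add: sum_chi_class_fun chi_class)
qed

end

text \<open>If antisymmetrising over the columns of the first tableau kills every tabloid of the second shape,
  then there is no nonzero equivariant map between the two Specht modules, and the convolution of the
  matrix coefficients vanishes by the same averaging as in \<open>coef_conv\<close>.\<close>
lemma chi_orthogonal:
  assumes "young n R C" "young n R' C'"
    and zero: "\<And>w p. w permutes {..<n} \<Longrightarrow> p permutes {..<n} \<Longrightarrow>
      (\<Sum>\<pi>\<in>C. rsign \<pi> * of_bool (w \<circ> \<pi> \<circ> p \<in> R')) = 0"
  shows "(\<Sum>p\<in>perms n. young.chi n R C p * young.chi n R' C' p) = 0"
proof -
  interpret A: young n R C by fact
  interpret B: young n R' C' by fact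
  have z: "(\<Sum>\<pi>\<in>C. rsign \<pi> * B.coef (w \<circ> \<pi> \<circ> p)) = 0"
    if w: "w permutes {..<n}" and p: "p permutes {..<n}" for w p
  proof -
    have "(\<Sum>\<pi>\<in>C. rsign \<pi> * B.coef (w \<circ> \<pi> \<circ> p)) =
      (\<Sum>\<sigma>\<in>C'. \<Sum>\<tau>\<in>C'. rsign \<sigma> * (rsign \<tau> * (\<Sum>\<pi>\<in>C. rsign \<pi> * of_bool ((\<sigma> \<circ> w) \<circ> \<pi> \<circ> (p \<circ> \<tau>) \<in> R'))))"
      unfolding B.coef_def B.eps_def sum_distrib_left
      by (subst sum.swap, rule sum.cong[OF refl], subst sum.swap) (simp add: o_assoc mult_ac)
    also have "\<dots> = 0"
      by (intro sum.neutral ballI) (simp add: zero w p B.CS permutes_compose)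
    finally show ?thesis .
  qed
  have "(\<Sum>p\<in>perms n. A.coef p * B.coef (x \<circ> p \<circ> q)) = 0"
    if x: "x permutes {..<n}" and q: "q permutes {..<n}" for x q
  proof -
    have "(\<Sum>p\<in>perms n. A.coef p * B.coef (x \<circ> p \<circ> q)) = (\<Sum>p\<in>perms n. A.coef p * (rsign \<pi> * B.coef (x \<circ> p \<circ> \<pi> \<circ> q)))"
      if \<pi>: "\<pi> \<in> C" for \<pi>
    proof -
      have "(\<Sum>p\<in>perms n. A.coef p * B.coef (x \<circ> p \<circ> q)) = (\<Sum>p\<in>perms n. A.coef (p \<circ> \<pi>) * B.coef (x \<circ> (p \<circ> \<pi>) \<circ> q))"
        by (rule sum_group_right[OF A.S, symmetric]) (use \<pi> A.CS in auto)
      also have "\<dots> = (\<Sum>p\<in>perms n. A.coef p * (rsign \<pi> * B.coef (x \<circ> p \<circ> \<pi> \<circ> q)))"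
        by (intro sum.cong refl) (use \<pi> in \<open>simp add: A.coef_right mult_ac o_assoc\<close>)
      finally show ?thesis .
    qed
    then have "card C * (\<Sum>p\<in>perms n. A.coef p * B.coef (x \<circ> p \<circ> q)) =
       (\<Sum>\<pi>\<in>C. \<Sum>p\<in>perms n. A.coef p * (rsign \<pi> * B.coef (x \<circ> p \<circ> \<pi> \<circ> q)))"
      by (metis (no_types, lifting) sum_constant sum.cong)
    also have "\<dots> = (\<Sum>p\<in>perms n. A.coef p * (\<Sum>\<pi>\<in>C. rsign \<pi> * B.coef (x \<circ> p \<circ> \<pi> \<circ> q)))"
      unfolding sum_distrib_left by (rule sum.swap)
    also have "\<dots> = 0"
      by (intro sum.neutral ballI) (simp add: z x q permutes_compose)
    finally show ?thesis using A.C_pos by simp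
  qed
  then have "(\<Sum>p\<in>perms n. A.coef p * B.coef (inv q \<circ> p \<circ> q)) = 0" if "q \<in> perms n" for q
    using that by (simp add: permutes_inv)
  then have "(\<Sum>q\<in>perms n. \<Sum>p\<in>perms n. A.coef p * B.coef (inv q \<circ> p \<circ> q)) = 0"
    by (rule sum.neutral[OF ballI])
  moreover have "(\<Sum>p\<in>perms n. A.coef p * B.chi p) = (\<Sum>q\<in>perms n. \<Sum>p\<in>perms n. A.coef p * B.coef (inv q \<circ> p \<circ> q)) / B.norm_const"
    unfolding B.chi_def by (subst sum.swap) (simp add: sum_divide_distrib sum_distrib_left)
  ultimately have "(\<Sum>p\<in>perms n. A.coef p * B.chi p) = 0" by simp
  then show ?thesis by (simp add: A.sum_chi_class_fun B.chi_class)
qed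

section \<open>Young's lemma and dominance\<close>

definition fiber_stab :: "nat \<Rightarrow> (nat \<Rightarrow> 'a) \<Rightarrow> (nat \<Rightarrow> nat) set" where
  "fiber_stab n f = {p. p permutes {..<n} \<and> (\<forall>x<n. f (p x) = f x)}"

lemma permutes_less: "p permutes {..<n} \<Longrightarrow> p x < n \<longleftrightarrow> x < n" for x n :: nat
  using permutes_in_image[of p "{..<n}" x] by simp

lemma perm_group_fiber_stab: "perm_group n (fiber_stab n f)"
proof -
  have "f (inv p x) = f x" if p: "p permutes {..<n}" "\<forall>x<n. f (p x) = f x" and x: "x < n" for p x
  proof -
    have "inv p x < n" using permutes_less[OF permutes_inv[OF p(1)]] x by blast
    then have "f (p (inv p x)) = f (inv p x)" using p(2) by blast
    then show ?thesis using permutes_inverses(1)[OF p(1)] by simp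
  qed
  then show ?thesis
    by (auto simp: perm_group_def fiber_stab_def permutes_id permutes_compose permutes_inv permutes_less)
qed

lemma fiber_stab_altdef:
  assumes p: "p permutes {..<n}"
  shows "p \<in> fiber_stab n f \<longleftrightarrow> (\<forall>j. p ` {x. x < n \<and> f x = j} = {x. x < n \<and> f x = j})"
proof
  assume p': "p \<in> fiber_stab n f"
  then have q: "inv p \<in> fiber_stab n f" by (rule perm_groupD(4)[OF perm_group_fiber_stab])
  show "\<forall>j. p ` {x. x < n \<and> f x = j} = {x. x < n \<and> f x = j}"
  proof (intro allI equalityI subsetI)
    fix j x assume "x \<in> {x. x < n \<and> f x = j}"
    then have "inv p x \<in> {x. x < n \<and> f x = j}" "x = p (inv p x)"
      using q p permutes_inverses(1)[OF p] permutes_less[OF permutes_inv[OF p], of x] by (auto simp: fiber_stab_def)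
    then show "x \<in> p ` {x. x < n \<and> f x = j}" by blast
  qed (use p' p in \<open>auto simp: fiber_stab_def permutes_less\<close>)
next
  assume H: "\<forall>j. p ` {x. x < n \<and> f x = j} = {x. x < n \<and> f x = j}"
  have "f (p x) = f x" if "x < n" for x
  proof -
    have "p x \<in> p ` {y. y < n \<and> f y = f x}" using that by blast
    then show ?thesis using H by auto
  qed
  with p show "p \<in> fiber_stab n f" by (simp add: fiber_stab_def)
qed

text \<open>A tableau, described by the row \<open>r x\<close> and the column \<open>c x\<close> of each entry \<open>x\<close>. Its row and column
  stabilisers are then \<open>fiber_stab n r\<close> and \<open>fiber_stab n c\<close>.\<close>
definition filling :: "nat \<Rightarrow> nat list \<Rightarrow> (nat \<Rightarrow> nat) \<Rightarrow> (nat \<Rightarrow> nat) \<Rightarrow> bool" where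
  "filling n lam r c \<longleftrightarrow> lam \<turnstile> n \<and> bij_betw (\<lambda>x. (r x, c x)) {..<n} (diagram lam)"

lemma filling_ex:
  assumes "filling n lam r c" "(i, j) \<in> diagram lam"
  obtains x where "x < n" "r x = i" "c x = j"
proof -
  have "(i, j) \<in> (\<lambda>x. (r x, c x)) ` {..<n}"
    using assms by (simp add: filling_def bij_betw_def)
  then show ?thesis using that by auto
qed

lemma filling_mem: "filling n lam r c \<Longrightarrow> x < n \<Longrightarrow> (r x, c x) \<in> diagram lam"
  by (auto simp: filling_def bij_betw_def)

lemma filling_inj: "filling n lam r c \<Longrightarrow> x < n \<Longrightarrow> y < n \<Longrightarrow> r x = r y \<Longrightarrow> c x = c y \<Longrightarrow> x = y"
  by (auto simp: filling_def bij_betw_def inj_on_def)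

lemma diagram_up:
  assumes "lam \<turnstile> n" "(i, j) \<in> diagram lam" "i' \<le> i"
  shows "(i', j) \<in> diagram lam"
proof (cases "i' = i")
  case False
  then have "lam ! i \<le> lam ! i'"
    using assms sorted_wrt_nth_less[of "(\<ge>)" lam i' i] by (auto simp: is_partition_def diagram_def)
  then show ?thesis using assms by (auto simp: diagram_def)
qed (use assms in simp)

lemma card_row:
  assumes F: "filling n lam r c"
  shows "card {x. x < n \<and> r x = i} = (if i < length lam then lam ! i else 0)"
proof -
  have "bij_betw (\<lambda>x. (r x, c x)) {x. x < n \<and> r x = i} {p \<in> diagram lam. fst p = i}"
  proof (rule bij_betw_subset[of _ "{..<n}" "diagram lam"])
    show "(\<lambda>x. (r x, c x)) ` {x. x < n \<and> r x = i} = {p \<in> diagram lam. fst p = i}"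
      using filling_mem[OF F] by (auto elim!: filling_ex[OF F] simp: image_iff)
  qed (use F in \<open>auto simp: filling_def\<close>)
  then have "card {x. x < n \<and> r x = i} = card {p \<in> diagram lam. fst p = i}"
    by (rule bij_betw_same_card)
  also have "{p \<in> diagram lam. fst p = i} = (if i < length lam then {i} \<times> {..<lam ! i} else {})"
    by (auto simp: diagram_def)
  finally show ?thesis by simp
qed

text \<open>Think of \<open>q x\<close> as the row of \<open>x\<close> in another tableau. If \<open>q\<close> separates the entries of a column, at
  most \<open>m\<close> of them lie in the first \<open>m\<close> rows there, while the given filling has the first \<open>m\<close> rows of
  each column full.\<close>
lemma filling_dominance:
  fixes q :: "nat \<Rightarrow> nat"
  assumes F: "filling n lam r c"
    and inj: "\<And>x y. x < n \<Longrightarrow> y < n \<Longrightarrow> c x = c y \<Longrightarrow> q x = q y \<Longrightarrow> x = y"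
  shows "card {x. x < n \<and> c x = j \<and> q x < m} \<le> card {x. x < n \<and> c x = j \<and> r x < m}" (is "card ?A \<le> card ?B")
proof (cases "\<forall>x<n. c x = j \<longrightarrow> r x < m")
  case True
  then show ?thesis by (intro card_mono) auto
next
  case False
  then obtain x0 where x0: "x0 < n" "c x0 = j" "m \<le> r x0" by force
  have "card ?A = card (q ` ?A)"
    by (rule card_image[symmetric]) (use inj in \<open>auto simp: inj_on_def\<close>)
  also have "\<dots> \<le> card {..<m}" by (intro card_mono) auto
  also have "\<dots> \<le> card (r ` ?B)"
  proof (intro card_mono subsetI)
    fix i assume "i \<in> {..<m}"
    then have "(i, j) \<in> diagram lam"
      using diagram_up[of lam n "r x0" j i] filling_mem[OF F x0(1)] x0 F by (auto simp: filling_def)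
    then obtain x where "x < n" "r x = i" "c x = j" by (rule filling_ex[OF F])
    with \<open>i \<in> {..<m}\<close> show "i \<in> r ` ?B" by auto
  qed auto
  also have "\<dots> \<le> card ?B" by (rule card_image_le) simp
  finally show ?thesis .
qed

lemma card_columns: "card {x. x < n \<and> P x} = (\<Sum>j\<in>c ` {..<n}. card {x. x < n \<and> c x = j \<and> P x})" for n :: nat
proof -
  have "card {x. x < n \<and> P x} = (\<Sum>x\<in>{x. x < n \<and> P x}. 1)" by simp
  also have "\<dots> = (\<Sum>j\<in>c ` {..<n}. \<Sum>x\<in>{x \<in> {x. x < n \<and> P x}. c x = j}. 1)"
    by (rule sum.group[symmetric]) auto
  also have "\<dots> = (\<Sum>j\<in>c ` {..<n}. card {x. x < n \<and> c x = j \<and> P x})"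
    by (intro sum.cong refl) (auto intro!: arg_cong[where f = card])
  finally show ?thesis .
qed

text \<open>This is the dominance order: if \<open>q\<close> is the row function of a tableau of shape \<open>\<mu>\<close>, the two sides
  are the partial sums of \<open>\<mu>\<close> and of the shape of the filling.\<close>
lemma filling_dominance_sum:
  fixes q :: "nat \<Rightarrow> nat"
  assumes F: "filling n lam r c"
    and inj: "\<And>x y. x < n \<Longrightarrow> y < n \<Longrightarrow> c x = c y \<Longrightarrow> q x = q y \<Longrightarrow> x = y"
  shows "card {x. x < n \<and> q x < m} \<le> card {x. x < n \<and> r x < m}"
  unfolding card_columns[where c = c and P = "\<lambda>x. q x < m"] card_columns[where c = c and P = "\<lambda>x. r x < m"]
  by (rule sum_mono, rule filling_dominance[OF F inj])

lemma card_less_Suc: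
  "card {x. x < n \<and> P x \<and> q x < Suc m} = card {x. x < n \<and> P x \<and> q x < m} + card {x. x < n \<and> P x \<and> q x = m}"
  for n :: nat and q :: "nat \<Rightarrow> nat"
proof -
  have "{x. x < n \<and> P x \<and> q x < Suc m} = {x. x < n \<and> P x \<and> q x < m} \<union> {x. x < n \<and> P x \<and> q x = m}"
    by auto
  then show ?thesis by (simp, subst card_Un_disjoint) auto
qed

text \<open>When the partial sums agree, the dominance inequality is an equality in each column separately, so
  every column meets the same rows in both tableaux and can be rearranged accordingly.\<close>
lemma filling_matching:
  fixes q :: "nat \<Rightarrow> nat"
  assumes F: "filling n lam r c"
    and inj: "\<And>x y. x < n \<Longrightarrow> y < n \<Longrightarrow> c x = c y \<Longrightarrow> q x = q y \<Longrightarrow> x = y"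
    and eq: "\<And>m. card {x. x < n \<and> q x < m} = card {x. x < n \<and> r x < m}"
  obtains \<pi> where "\<pi> \<in> fiber_stab n c" "\<And>x. x < n \<Longrightarrow> q (\<pi> x) = r x"
proof -
  have eqj: "card {x. x < n \<and> c x = j \<and> q x < m} = card {x. x < n \<and> c x = j \<and> r x < m}" for j m
  proof (cases "j \<in> c ` {..<n}")
    case True
    show ?thesis
      by (rule sum_mono_inv[where I = "c ` {..<n}", OF _ filling_dominance[OF F inj] True])
        (use eq[of m] in \<open>simp_all add: card_columns[where c = c and P = "\<lambda>x. q x < m"] card_columns[where c = c and P = "\<lambda>x. r x < m"]\<close>)
  next
    case False
    then have "{x. x < n \<and> c x = j \<and> q x < m} = {}" "{x. x < n \<and> c x = j \<and> r x < m} = {}" by auto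
    then show ?thesis by (simp only:)
  qed
  have "card {x. x < n \<and> c x = j \<and> q x = i} = card {x. x < n \<and> c x = j \<and> r x = i}" for i j
    using eqj[of j "Suc i"] eqj[of j i] by (simp add: card_less_Suc)
  then have "card {x \<in> {..<n}. (c x, r x) = b} = card {x \<in> {..<n}. (c x, q x) = b}" for b
    by (cases b) simp
  then have "image_mset (\<lambda>x. (c x, r x)) (mset_set {..<n}) = image_mset (\<lambda>x. (c x, q x)) (mset_set {..<n})"
    by (intro multiset_eqI) (simp add: count_image_mset_eq_card_vimage)
  then obtain \<pi> where "\<pi> permutes {..<n}" "\<forall>x\<in>{..<n}. (c x, r x) = (c (\<pi> x), q (\<pi> x))"
    by (rule image_mset_eq_implies_permutes[rotated]) auto
  then show ?thesis by (intro that[of \<pi>]) (auto simp: fiber_stab_def)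
qed

lemma card_perm_less:
  fixes n :: nat
  assumes "p permutes {..<n}"
  shows "card {x. x < n \<and> P (p x)} = card {x. x < n \<and> P x}"
proof -
  have "bij_betw p {x. x < n \<and> P (p x)} {x. x < n \<and> P x}"
  proof (rule bij_betw_byWitness[where f' = "inv p"])
  qed (use assms permutes_inverses[OF assms] permutes_less[OF assms] permutes_less[OF permutes_inv[OF assms]] in auto)
  then show ?thesis by (rule bij_betw_same_card)
qed

text \<open>Two entries in a common column that also share a row of the tabloid moved by \<open>p\<close> define a
  transposition in the column stabiliser that fixes this tabloid; it pairs off the terms with opposite signs.\<close>
lemma filling_swap_zero:
  fixes r' :: "nat \<Rightarrow> nat"
  assumes x: "x < n" and y: "y < n" and ne: "x \<noteq> y" and c: "c x = c y" and p: "p permutes {..<n}"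
    and w: "w permutes {..<n}"
    and r': "r' (inv p x) = r' (inv p y)"
  shows "(\<Sum>\<pi>\<in>fiber_stab n c. rsign \<pi> * of_bool (w \<circ> \<pi> \<circ> p \<in> fiber_stab n r')) = 0"
proof -
  let ?C = "fiber_stab n c" and ?R = "fiber_stab n r'"
  define s where "s = Transposition.transpose x y"
  have s: "s permutes {..<n}" unfolding s_def by (rule permutes_swap_id) (use x y in auto)
  have sC: "s \<in> ?C" using s c by (auto simp: fiber_stab_def s_def transpose_def)
  have gR: "inv p \<circ> s \<circ> p \<in> ?R"
  proof -
    have "r' (inv p (s (p z))) = r' z" if "z < n" for z
    proof -
      have "z = inv p x" if "p z = x" using that permutes_inverses(2)[OF p, of z] by simp
      moreover have "z = inv p y" if "p z = y" using that permutes_inverses(2)[OF p, of z] by simp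
      ultimately show ?thesis
        using r' permutes_inverses(2)[OF p, of z] by (auto simp: s_def transpose_def)
    qed
    then show ?thesis using s p by (auto simp: fiber_stab_def intro!: permutes_compose permutes_inv)
  qed
  have ss: "s \<circ> (s \<circ> p) = p" by (simp add: s_def fun_eq_iff)
  have iff: "w \<circ> \<pi> \<circ> (s \<circ> p) \<in> ?R \<longleftrightarrow> w \<circ> \<pi> \<circ> p \<in> ?R" for \<pi>
  proof -
    have 1: "w \<circ> \<pi> \<circ> (s \<circ> p) = (w \<circ> \<pi> \<circ> p) \<circ> (inv p \<circ> s \<circ> p)"
      by (simp add: o_assoc[symmetric] perm_inv_cancel[OF p])
    have 2: "(w \<circ> \<pi> \<circ> (s \<circ> p)) \<circ> (inv p \<circ> s \<circ> p) = w \<circ> \<pi> \<circ> p"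
      by (simp add: o_assoc[symmetric] perm_inv_cancel[OF p] ss)
    show ?thesis
    proof
      assume "w \<circ> \<pi> \<circ> (s \<circ> p) \<in> ?R"
      then show "w \<circ> \<pi> \<circ> p \<in> ?R" unfolding 2[symmetric] by (rule perm_groupD(3)[OF perm_group_fiber_stab _ gR])
    next
      assume "w \<circ> \<pi> \<circ> p \<in> ?R"
      then show "w \<circ> \<pi> \<circ> (s \<circ> p) \<in> ?R" unfolding 1 by (rule perm_groupD(3)[OF perm_group_fiber_stab _ gR])
    qed
  qed
  have "(\<Sum>\<pi>\<in>?C. rsign \<pi> * of_bool (w \<circ> \<pi> \<circ> p \<in> ?R)) =
      (\<Sum>\<pi>\<in>?C. rsign (\<pi> \<circ> s) * of_bool (w \<circ> (\<pi> \<circ> s) \<circ> p \<in> ?R))"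
    by (rule sum_group_right[OF perm_group_fiber_stab sC, symmetric])
  also have "\<dots> = (\<Sum>\<pi>\<in>?C. - (rsign \<pi> * of_bool (w \<circ> \<pi> \<circ> p \<in> ?R)))"
  proof (intro sum.cong refl)
    fix \<pi> assume "\<pi> \<in> ?C"
    then have "rsign (\<pi> \<circ> s) = rsign \<pi> * rsign s" using s by (intro rsign_compose[of _ n]) (auto simp: fiber_stab_def)
    also have "rsign s = -1" using ne by (simp add: rsign_def s_def sign_swap_id)
    finally show "rsign (\<pi> \<circ> s) * of_bool (w \<circ> (\<pi> \<circ> s) \<circ> p \<in> ?R) = - (rsign \<pi> * of_bool (w \<circ> \<pi> \<circ> p \<in> ?R))"
      using iff[of \<pi>] by (simp only: o_assoc)
  qed
  finally show ?thesis by (simp add: sum_negf)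
qed

text \<open>If \<open>p\<close> does not lie in \<open>C R\<close>, both sides vanish by \<open>filling_swap_zero\<close>. Otherwise \<open>filling_matching\<close>
  provides the factor in \<open>C\<close>, which only contributes its sign.\<close>
lemma young_filling:
  assumes F: "filling n lam r c"
  shows "young n (fiber_stab n r) (fiber_stab n c)"
proof -
  let ?R = "fiber_stab n r" and ?C = "fiber_stab n c"
  have "p = id" if "p \<in> ?R \<inter> ?C" for p
  proof
    fix x
    show "p x = id x"
    proof (cases "x < n")
      case True
      then have "r (p x) = r x" "c (p x) = c x" "p x < n" using that by (auto simp: fiber_stab_def permutes_less)
      then show ?thesis using filling_inj[OF F _ True] by auto
    next
      case False
      then show ?thesis using that by (auto simp: fiber_stab_def permutes_def)
    qed
  qed
  then have base: "young_base n ?R ?C"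
    using perm_groupD(2)[OF perm_group_fiber_stab]
    by unfold_locales (auto simp: perm_group_fiber_stab)
  interpret young_base n ?R ?C by (rule base)
  show ?thesis
  proof unfold_locales
    fix w p assume w: "w permutes {..<n}" and p: "p permutes {..<n}"
    show "(\<Sum>\<pi>\<in>?C. rsign \<pi> * of_bool (w \<circ> \<pi> \<circ> p \<in> ?R)) = eps w * eps (inv p)"
    proof (cases "\<exists>x y. x < n \<and> y < n \<and> x \<noteq> y \<and> c x = c y \<and> r (inv p x) = r (inv p y)")
      case True
      then obtain x y where xy: "x < n" "y < n" "x \<noteq> y" "c x = c y" "r (inv p x) = r (inv p y)" by blast
      have "eps (inv p) = (\<Sum>\<pi>\<in>?C. rsign \<pi> * of_bool (id \<circ> \<pi> \<circ> p \<in> ?R))"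
        unfolding eps_inv[OF p] by simp
      also have "\<dots> = 0" by (rule filling_swap_zero[OF xy(1-4) p permutes_id xy(5)])
      finally show ?thesis using filling_swap_zero[OF xy(1-4) p w xy(5)] by simp
    next
      case False
      then have no: "x = y" if "x < n" "y < n" "c x = c y" "r (inv p x) = r (inv p y)" for x y
        using that by blast
      obtain \<rho> where \<rho>: "\<rho> \<in> ?C" "\<And>x. x < n \<Longrightarrow> r (inv p (\<rho> x)) = r x"
      proof (rule filling_matching[OF F, of "\<lambda>x. r (inv p x)"])
        show "card {x. x < n \<and> r (inv p x) < m} = card {x. x < n \<and> r x < m}" for m
          by (rule card_perm_less[OF permutes_inv[OF p]])
      qed (use no in auto)
      define \<sigma> where "\<sigma> = inv p \<circ> \<rho>"
      have \<rho>p: "\<rho> permutes {..<n}" using \<rho>(1) CS by blast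
      have "\<sigma> \<in> ?R" using \<rho> p \<rho>p by (auto simp: \<sigma>_def fiber_stab_def intro!: permutes_compose permutes_inv)
      then have \<sigma>R: "inv \<sigma> \<in> ?R" by (rule perm_groupD(4)[OF R])
      have p_eq: "p = \<rho> \<circ> inv \<sigma>"
        using p \<rho>p by (simp add: \<sigma>_def perm_inv_comp[of _ "{..<n}"] permutes_inv perm_inv_cancel(5)[OF p] perm_inv_cancel(4)[OF \<rho>p])
      have key: "(\<Sum>\<pi>\<in>?C. rsign \<pi> * of_bool (v \<circ> \<pi> \<circ> p \<in> ?R)) = rsign \<rho> * eps v" if v: "v permutes {..<n}" for v
      proof -
        have "v \<circ> \<pi> \<circ> p \<in> ?R \<longleftrightarrow> v \<circ> \<pi> \<circ> \<rho> \<in> ?R" for \<pi>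
        proof -
          have "v \<circ> \<pi> \<circ> p = (v \<circ> \<pi> \<circ> \<rho>) \<circ> inv \<sigma>" "v \<circ> \<pi> \<circ> \<rho> = (v \<circ> \<pi> \<circ> p) \<circ> \<sigma>"
            using RS[OF \<open>\<sigma> \<in> ?R\<close>] by (simp_all add: p_eq o_assoc[symmetric] perm_inv_cancel)
          then show ?thesis using perm_groupD(3)[OF R] \<sigma>R \<open>\<sigma> \<in> ?R\<close> by metis
        qed
        then have "(\<Sum>\<pi>\<in>?C. rsign \<pi> * of_bool (v \<circ> \<pi> \<circ> p \<in> ?R)) = (\<Sum>\<pi>\<in>?C. rsign \<rho> * (rsign (\<pi> \<circ> \<rho>) * of_bool (v \<circ> (\<pi> \<circ> \<rho>) \<in> ?R)))"
          by (intro sum.cong refl) (simp add: rsign_compose[of _ n] CS \<rho>p o_assoc mult_ac)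
        also have "\<dots> = rsign \<rho> * eps v"
          unfolding eps_def sum_distrib_left by (rule sum_group_right[OF C \<rho>(1)])
        finally show ?thesis .
      qed
      have "eps (inv p) = rsign \<rho>" using key[OF permutes_id] by (simp add: eps_inv[OF p] eps_id)
      then show ?thesis using key[OF w] by simp
    qed
  qed
qed

lemma filling_partition_eq:
  assumes F: "filling n lam r c" and F': "filling n mu r' c'"
    and eq: "\<And>m. card {x. x < n \<and> r x < m} = card {x. x < n \<and> r' x < m}"
  shows "lam = mu"
proof -
  have "card {x. x < n \<and> r x = i} = card {x. x < n \<and> r' x = i}" for i
    using eq[of "Suc i"] eq[of i] card_less_Suc[of n "\<lambda>_. True" r i] card_less_Suc[of n "\<lambda>_. True" r' i] by simp
  then have *: "(if i < length lam then lam ! i else 0) = (if i < length mu then mu ! i else 0)" for i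
    using card_row[OF F, of i] card_row[OF F', of i] by simp
  have pos: "lam ! i > 0" if "i < length lam" for i using that F
    by (metis filling_def is_partition_def gr0I nth_mem)
  have pos': "mu ! i > 0" if "i < length mu" for i using that F'
    by (metis filling_def is_partition_def gr0I nth_mem)
  have len: "length lam = length mu"
  proof (rule antisym)
    show "length lam \<le> length mu" using *[of "length mu"] pos[of "length mu"] by (auto split: if_splits)
    show "length mu \<le> length lam" using *[of "length lam"] pos'[of "length lam"] by (auto split: if_splits)
  qed
  show ?thesis
  proof (rule nth_equalityI[OF len])
    fix i assume "i < length lam"
    then show "lam ! i = mu ! i" using *[of i] len by simp
  qed
qed

text \<open>If the antisymmetrisers do not vanish in either direction, each shape dominates the other and they
  coincide.\<close>
lemma filling_chi_orthogonal:
  assumes F: "filling n lam r c" and F': "filling n mu r' c'" and ne: "lam \<noteq> mu"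
  shows "(\<Sum>p\<in>perms n. young.chi n (fiber_stab n r) (fiber_stab n c) p * young.chi n (fiber_stab n r') (fiber_stab n c') p) = 0"
proof -
  have dom: "card {x. x < n \<and> r' x < m} \<le> card {x. x < n \<and> r x < m}"
    if F: "filling n lam r c" and p: "p permutes {..<n}" and no: "\<nexists>x y. x < n \<and> y < n \<and> x \<noteq> y \<and> c x = c y \<and> r' (inv p x) = r' (inv p y)"
    for lam r c p m and r' :: "nat \<Rightarrow> nat"
  proof -
    have "card {x. x < n \<and> r' (inv p x) < m} \<le> card {x. x < n \<and> r x < m}"
      by (rule filling_dominance_sum[OF F]) (use no in blast)
    then show ?thesis by (simp add: card_perm_less[OF permutes_inv[OF p], of "\<lambda>x. r' x < m"])
  qed
  let ?Z = "\<lambda>r c r'. \<forall>p w. p permutes {..<n} \<longrightarrow> w permutes {..<n} \<longrightarrow> (\<Sum>\<pi>\<in>fiber_stab n c. rsign \<pi> * of_bool (w \<circ> \<pi> \<circ> p \<in> fiber_stab n r')) = 0"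
  have "?Z r c r' \<or> ?Z r' c' r"
  proof (rule ccontr)
    assume "\<not> ?thesis"
    then obtain p w p' w' where p: "p permutes {..<n}" "w permutes {..<n}" "(\<Sum>\<pi>\<in>fiber_stab n c. rsign \<pi> * of_bool (w \<circ> \<pi> \<circ> p \<in> fiber_stab n r')) \<noteq> 0"
      and p': "p' permutes {..<n}" "w' permutes {..<n}" "(\<Sum>\<pi>\<in>fiber_stab n c'. rsign \<pi> * of_bool (w' \<circ> \<pi> \<circ> p' \<in> fiber_stab n r)) \<noteq> 0"
      by blast
    have "card {x. x < n \<and> r' x < m} \<le> card {x. x < n \<and> r x < m}" for m
      by (rule dom[OF F p(1)]) (use filling_swap_zero[OF _ _ _ _ p(1,2)] p(3) in blast)
    moreover have "card {x. x < n \<and> r x < m} \<le> card {x. x < n \<and> r' x < m}" for m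
      by (rule dom[OF F' p'(1)]) (use filling_swap_zero[OF _ _ _ _ p'(1,2)] p'(3) in blast)
    ultimately have "lam = mu" by (intro filling_partition_eq[OF F F']) (simp add: antisym)
    with ne show False by simp
  qed
  then show ?thesis
  proof
    assume "?Z r c r'"
    then show ?thesis by (intro chi_orthogonal[OF young_filling[OF F] young_filling[OF F']]) blast
  next
    assume "?Z r' c' r"
    then have "(\<Sum>p\<in>perms n. young.chi n (fiber_stab n r') (fiber_stab n c') p * young.chi n (fiber_stab n r) (fiber_stab n c) p) = 0"
      by (intro chi_orthogonal[OF young_filling[OF F'] young_filling[OF F]]) blast
    then show ?thesis by (simp add: mult.commute)
  qed
qed

section \<open>Specht characters as averaged matrix coefficients\<close>

lemma sum_fun_apply: "(\<Sum>x\<in>A. g x) y = (\<Sum>x\<in>A. g x y)" for g :: "'a \<Rightarrow> 'b \<Rightarrow> complex"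
  by (induction A rule: infinite_finite_induct) auto

text \<open>A finite family \<open>E\<close> with dual functionals \<open>\<phi>\<close> that reproduces the vectors of \<open>V\<close> computes traces in
  the same way as a basis, even if \<open>E\<close> is linearly dependent. The polytabloids are such a family.\<close>
lemma trace_on_frame:
  fixes T :: "('a \<Rightarrow> complex) \<Rightarrow> 'a \<Rightarrow> complex" and E :: "'i \<Rightarrow> 'a \<Rightarrow> complex"
    and \<phi> :: "'i \<Rightarrow> ('a \<Rightarrow> complex) \<Rightarrow> complex"
  assumes lin: "Vector_Spaces.linear cscale cscale T"
    and inv: "\<And>v. v \<in> V \<Longrightarrow> T v \<in> V"
    and fin: "finite I" and V: "V = cfun.span (E ` I)"
    and add: "\<And>i u v. i \<in> I \<Longrightarrow> \<phi> i (u + v) = \<phi> i u + \<phi> i v"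
    and scale: "\<And>i z v. i \<in> I \<Longrightarrow> \<phi> i (cscale z v) = z * \<phi> i v"
    and frame: "\<And>j. j \<in> I \<Longrightarrow> E j = (\<Sum>i\<in>I. cscale (\<phi> i (E j)) (E i))"
  shows "trace_on V T = (\<Sum>i\<in>I. \<phi> i (T (E i)))"
proof -
  interpret T: Vector_Spaces.linear cscale cscale T by (fact lin)
  obtain B where B: "B \<subseteq> E ` I" "cfun.independent B" "E ` I \<subseteq> cfun.span B"
    using cfun.maximal_independent_subset[of "E ` I"] by blast
  have finB: "finite B" using B(1) fin by (auto intro: finite_subset)
  have spanB: "cfun.span B = V"
    using B(1,3) cfun.span_mono[OF B(1)] cfun.span_minimal[OF B(3)] by (auto simp: V)
  have EV: "E i \<in> V" if "i \<in> I" for i using that by (auto simp: V intro: cfun.span_base)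
  have phi0: "\<phi> i 0 = 0" if "i \<in> I" for i using add[OF that, of 0 0] by simp
  have phi_sum: "\<phi> i (\<Sum>x\<in>A. f x) = (\<Sum>x\<in>A. \<phi> i (f x))" if "i \<in> I" for i f and A :: "('a \<Rightarrow> complex) set"
    by (induction A rule: infinite_finite_induct)
      (simp_all only: simp_thms sum.infinite sum.empty sum.insert phi0[OF that] add[OF that])
  let ?r = "cfun.representation B"
  have rB: "(\<Sum>b\<in>B. cscale (?r v b) b) = v" if "v \<in> V" for v
    by (rule cfun.sum_representation_eq) (use B finB spanB that in auto)
  have step: "?r (T b) b = (\<Sum>i\<in>I. \<phi> i b * ?r (T (E i)) b)" if b: "b \<in> B" for b
  proof -
    obtain j where j: "j \<in> I" "b = E j" using b B(1) by blast
    have "T b = (\<Sum>i\<in>I. cscale (\<phi> i b) (T (E i)))"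
      by (subst j(2), subst frame[OF j(1)]) (simp add: T.sum T.scale j(2))
    then have "?r (T b) b = ?r (\<Sum>i\<in>I. cscale (\<phi> i b) (T (E i))) b" by simp
    also have "\<dots> = (\<Sum>i\<in>I. ?r (cscale (\<phi> i b) (T (E i))) b)"
      by (subst cfun.representation_sum) (use B spanB inv EV in \<open>auto intro!: cfun.span_scale\<close>)
    also have "\<dots> = (\<Sum>i\<in>I. \<phi> i b * ?r (T (E i)) b)"
      by (intro sum.cong refl, subst cfun.representation_scale) (use B spanB inv EV in auto)
    finally show ?thesis .
  qed
  have "trace_on V T = (\<Sum>b\<in>B. ?r (T b) b)"
    by (rule trace_on_eq[OF lin inv finB B(2) spanB])
  also have "\<dots> = (\<Sum>i\<in>I. \<Sum>b\<in>B. \<phi> i b * ?r (T (E i)) b)"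
    by (simp add: step) (rule sum.swap)
  also have "\<dots> = (\<Sum>i\<in>I. \<phi> i (\<Sum>b\<in>B. cscale (?r (T (E i)) b) b))"
    by (intro sum.cong refl) (simp add: phi_sum scale mult.commute)
  also have "\<dots> = (\<Sum>i\<in>I. \<phi> i (T (E i)))"
    by (intro sum.cong refl) (simp add: rB inv EV)
  finally show ?thesis .
qed

lemma card_diagram: "card (diagram lam) = sum_list lam"
proof -
  have "diagram lam = (SIGMA i:{..<length lam}. {..<lam ! i})"
    by (auto simp: diagram_def)
  then have "card (diagram lam) = (\<Sum>i<length lam. lam ! i)" by (simp add: card_SigmaI)
  also have "\<dots> = sum_list lam" by (simp add: sum_list_sum_nth atLeast0LessThan)
  finally show ?thesis .
qed

lemma finite_diagram: "finite (diagram lam)"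
proof -
  have "diagram lam = (SIGMA i:{..<length lam}. {..<lam ! i})"
    by (auto simp: diagram_def)
  then show ?thesis by simp
qed

lemma tableau_exists: "\<exists>t. t \<in> tableaux lam"
  unfolding tableaux_def using finite_same_card_bij[OF finite_diagram, of "{..<sum_list lam}"]
  by (auto simp: card_diagram)

lemma polytabloid_cong:
  assumes "\<And>p. p \<in> diagram lam \<Longrightarrow> s p = t p"
  shows "polytabloid lam s = polytabloid lam t"
proof -
  have "col lam s = col lam t"
    by (rule ext) (auto simp: col_def assms intro!: image_cong)
  moreover have "tabloid lam (\<pi> \<circ> s) = tabloid lam (\<pi> \<circ> t)" for \<pi>
    by (rule ext) (auto simp: tabloid_def assms intro!: image_cong)
  ultimately show ?thesis
    unfolding polytabloid_def column_stabilizer_def by simp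
qed

text \<open>For a tableau \<open>t\<close>, the family is \<open>E p\<close>, the polytabloid of \<open>p \<circ> t\<close>, and \<open>\<phi> p\<close> is the inner
  product with \<open>E p\<close>, divided by the frame constant. The trace of \<open>p\<close> becomes the sum of
  \<open>\<phi> q (E (p \<circ> q))\<close>, which is \<open>chi p\<close>.\<close>
lemma specht_char_young:
  assumes lam: "lam \<turnstile> n"
  obtains r c where "filling n lam r c"
    "\<And>p. p permutes {..<n} \<Longrightarrow>
      specht_char lam p = of_real (young.chi n (fiber_stab n r) (fiber_stab n c) p)"
proof -
  have n: "sum_list lam = n" using lam by (simp add: is_partition_def)
  obtain t where tT: "t \<in> tableaux lam" using tableau_exists by blast
  then have t: "bij_betw t (diagram lam) {..<n}" by (simp add: tableaux_def n)
  define u where "u = inv_into (diagram lam) t"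
  have u: "bij_betw u {..<n} (diagram lam)" unfolding u_def by (rule bij_betw_inv_into[OF t])
  have ut: "u (t p) = p" if "p \<in> diagram lam" for p
    using that t by (simp add: u_def bij_betw_def)
  have tu: "t (u x) = x" if "x < n" for x
    using that t by (simp add: u_def bij_betw_def f_inv_into_f)
  have tn: "t p < n" if "p \<in> diagram lam" for p using bij_betwE[OF t] that by auto
  have uD: "u x \<in> diagram lam" if "x < n" for x using bij_betwE[OF u] that by auto
  define r where "r x = fst (u x)" for x
  define c where "c x = snd (u x)" for x
  have F: "filling n lam r c" using lam u by (simp add: filling_def r_def c_def)
  let ?R = "fiber_stab n r" and ?C = "fiber_stab n c"
  interpret young n ?R ?C by (rule young_filling[OF F])
  have img: "t ` {p \<in> diagram lam. Q p} = {x. x < n \<and> Q (u x)}" for Q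
  proof (intro equalityI subsetI)
    fix x assume "x \<in> {x. x < n \<and> Q (u x)}"
    then have "x = t (u x)" "u x \<in> {p \<in> diagram lam. Q p}" using tu uD by auto
    then show "x \<in> t ` {p \<in> diagram lam. Q p}" by blast
  qed (use ut tn in auto)
  have col: "col lam t j = {x. x < n \<and> c x = j}" for j
    unfolding col_def img c_def ..
  have Cst: "column_stabilizer lam t = ?C"
  proof (rule set_eqI)
    fix \<pi>
    show "\<pi> \<in> column_stabilizer lam t \<longleftrightarrow> \<pi> \<in> ?C"
    proof (cases "\<pi> permutes {..<n}")
      case True
      then show ?thesis unfolding column_stabilizer_def n col fiber_stab_altdef[OF True] by simp
    qed (simp add: column_stabilizer_def n fiber_stab_def)
  qed
  define \<T> where "\<T> p = tabloid lam (p \<circ> t)" for p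
  have T: "\<T> p = (\<lambda>i. p ` {x. x < n \<and> r x = i})" for p
    unfolding \<T>_def tabloid_def image_comp[symmetric] img r_def ..
  have Tact: "(\<lambda>i. p ` \<T> q i) = \<T> (p \<circ> q)" for p q
    by (simp add: T image_comp)
  have Teq: "\<T> p = \<T> q \<longleftrightarrow> inv p \<circ> q \<in> ?R" if p: "p permutes {..<n}" and q: "q permutes {..<n}" for p q
  proof -
    have "\<T> p = \<T> q \<longleftrightarrow> (\<forall>i. p ` {x. x < n \<and> r x = i} = q ` {x. x < n \<and> r x = i})"
      by (simp add: T fun_eq_iff)
    also have "\<dots> \<longleftrightarrow> (\<forall>i. (inv p \<circ> q) ` {x. x < n \<and> r x = i} = {x. x < n \<and> r x = i})"
    proof -
      have "p ` A = q ` A \<longleftrightarrow> (inv p \<circ> q) ` A = A" for A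
      proof
        assume "p ` A = q ` A"
        then have "(inv p \<circ> q) ` A = inv p ` p ` A" by (simp add: image_comp)
        then show "(inv p \<circ> q) ` A = A" by (simp add: image_comp perm_inv_cancel[OF p])
      next
        assume "(inv p \<circ> q) ` A = A"
        then have "p ` A = (p \<circ> (inv p \<circ> q)) ` A" by (metis image_comp)
        then show "p ` A = q ` A" by (simp add: perm_inv_cancel(4)[OF p])
      qed
      then show ?thesis by simp
    qed
    also have "\<dots> \<longleftrightarrow> inv p \<circ> q \<in> ?R"
      by (rule fiber_stab_altdef[symmetric]) (simp add: p q permutes_compose permutes_inv)
    finally show ?thesis .
  qed
  define E where "E p = polytabloid lam (p \<circ> t)" for p
  have E_act: "E p = perm_act p (polytabloid lam t)" if "p permutes {..<n}" for p
    using perm_act_polytabloid[of p lam t] that n by (simp add: E_def)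
  \<comment> \<open>The coefficients of polytabloids are the values of \<open>eps\<close>, and they vanish off the orbit of the tabloid of \<open>t\<close>.\<close>
  have E_T: "E p (\<T> w) = of_real (eps (inv w \<circ> p))" if p: "p permutes {..<n}" and w: "w permutes {..<n}" for p w
  proof -
    have "E p (\<T> w) = polytabloid lam t (\<T> (inv p \<circ> w))"
      by (simp add: E_act[OF p] perm_act_def Tact)
    also have "\<dots> = (\<Sum>\<pi>\<in>?C. of_int (sign \<pi>) * (if \<T> (inv p \<circ> w) = \<T> \<pi> then 1 else 0))"
      by (simp add: polytabloid_def Cst \<T>_def)
    also have "\<dots> = (\<Sum>\<pi>\<in>?C. of_real (rsign \<pi> * of_bool (inv w \<circ> p \<circ> \<pi> \<in> ?R)))"
    proof (intro sum.cong refl)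
      fix \<pi> assume "\<pi> \<in> ?C"
      then have "\<pi> permutes {..<n}" by (rule CS)
      then have "\<T> (inv p \<circ> w) = \<T> \<pi> \<longleftrightarrow> inv w \<circ> p \<circ> \<pi> \<in> ?R"
        by (subst Teq) (simp_all add: p w permutes_compose permutes_inv perm_inv_comp[of _ "{..<n}"] perm_inv_cancel(5)[OF p])
      then show "of_int (sign \<pi>) * (if \<T> (inv p \<circ> w) = \<T> \<pi> then 1 else 0) = complex_of_real (rsign \<pi> * of_bool (inv w \<circ> p \<circ> \<pi> \<in> ?R))"
        by (simp add: rsign_def)
    qed
    also have "\<dots> = of_real (eps (inv w \<circ> p))" by (simp add: eps_def)
    finally show ?thesis .
  qed
  have E_0: "E p X = 0" if p: "p permutes {..<n}" and X: "X \<notin> \<T> ` perms n" for p X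
  proof -
    have "(\<lambda>i. inv p ` X i) \<noteq> \<T> \<pi>" if "\<pi> \<in> ?C" for \<pi>
    proof
      assume "(\<lambda>i. inv p ` X i) = \<T> \<pi>"
      then have "(\<lambda>i. p ` inv p ` X i) = (\<lambda>i. p ` \<T> \<pi> i)" by (metis (no_types, lifting))
      then have "X = \<T> (p \<circ> \<pi>)" by (simp add: Tact image_comp perm_inv_cancel[OF p])
      moreover have "p \<circ> \<pi> permutes {..<n}" using CS[OF that] p by (simp add: permutes_compose)
      ultimately show False using X by blast
    qed
    then have "polytabloid lam t (\<lambda>i. inv p ` X i) = 0"
      unfolding polytabloid_def Cst \<T>_def[symmetric] by (intro sum.neutral) auto
    then show ?thesis by (simp add: E_act[OF p] perm_act_def)
  qed
  define \<phi> where "\<phi> p v = (\<Sum>\<pi>\<in>?C. of_real (rsign \<pi> / norm_const) * v (\<T> (p \<circ> \<pi>)))" for p and v :: "(nat \<Rightarrow> nat set) \<Rightarrow> complex"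
  have phi_E: "\<phi> p (E q) = of_real (coef (inv p \<circ> q) / norm_const)" if p: "p permutes {..<n}" and q: "q permutes {..<n}" for p q
  proof -
    have "\<phi> p (E q) = of_real (\<Sum>\<pi>\<in>?C. rsign \<pi> * eps (inv \<pi> \<circ> (inv p \<circ> q)) / norm_const)"
      unfolding \<phi>_def of_real_sum
      by (intro sum.cong refl) (simp add: E_T p q CS permutes_compose perm_inv_comp[of _ "{..<n}"] o_assoc)
    also have "(\<Sum>\<pi>\<in>?C. rsign \<pi> * eps (inv \<pi> \<circ> (inv p \<circ> q)) / norm_const)
      = (\<Sum>\<pi>\<in>?C. rsign (inv \<pi>) * eps (inv (inv \<pi>) \<circ> (inv p \<circ> q)) / norm_const)"
      by (rule sum_group_inv[OF C, symmetric])
    also have "\<dots> = coef (inv p \<circ> q) / norm_const"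
      unfolding coef_def sum_divide_distrib
      by (intro sum.cong refl) (simp add: rsign_inv[of _ n] CS perm_inv_cancel(5)[of _ "{..<n}"])
    finally show ?thesis .
  qed
  have frame: "E q = (\<Sum>p\<in>perms n. cscale (\<phi> p (E q)) (E p))" if "q \<in> perms n" for q
  proof
    fix X
    have q: "q permutes {..<n}" using that by simp
    show "E q X = (\<Sum>p\<in>perms n. cscale (\<phi> p (E q)) (E p)) X"
    proof (cases "X \<in> \<T> ` perms n")
      case True
      then obtain w where w: "w permutes {..<n}" "X = \<T> w" by auto
      have "(\<Sum>p\<in>perms n. cscale (\<phi> p (E q)) (E p)) X = of_real (\<Sum>p\<in>perms n. eps (inv w \<circ> p) * coef (inv p \<circ> q) / norm_const)"
        unfolding sum_fun_apply of_real_sum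
        by (intro sum.cong refl) (simp add: cscale_def phi_E q w E_T)
      also have "(\<Sum>p\<in>perms n. eps (inv w \<circ> p) * coef (inv p \<circ> q) / norm_const) = eps (inv w \<circ> q)"
        unfolding sum_divide_distrib[symmetric] using norm_const_pos by (simp add: eps_reproducing q w permutes_inv)
      finally show ?thesis by (simp add: w q E_T)
    next
      case False
      then show ?thesis by (simp add: sum_fun_apply cscale_def E_0 q)
    qed
  qed
  have "polytabloid lam ` tableaux lam = E ` perms n"
  proof (intro equalityI subsetI)
    fix x assume "x \<in> E ` perms n"
    then obtain p where "p permutes {..<n}" "x = E p" by auto
    then show "x \<in> polytabloid lam ` tableaux lam"
      using t permutes_imp_bij[of p] by (auto simp: E_def tableaux_def n intro!: imageI intro: bij_betw_trans)
  next
    fix x assume "x \<in> polytabloid lam ` tableaux lam"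
    then obtain s where s: "bij_betw s (diagram lam) {..<n}" "x = polytabloid lam s" by (auto simp: tableaux_def n)
    \<comment> \<open>A tableau may take arbitrary values outside the diagram; only \<open>s \<circ> u\<close> on the letters matters.\<close>
    define p where "p = (\<lambda>x. if x < n then s (u x) else x)"
    have "bij_betw (s \<circ> u) {..<n} {..<n}" using u s(1) by (rule bij_betw_trans)
    then have "bij_betw p {..<n} {..<n}" by (rule bij_betw_cong[THEN iffD1, rotated]) (simp add: p_def)
    then have "p permutes {..<n}" by (rule bij_imp_permutes) (simp add: p_def)
    moreover have "x = E p" unfolding s(2) E_def by (rule polytabloid_cong) (simp add: p_def tn ut)
    ultimately show "x \<in> E ` perms n" by blast
  qed
  then have V: "specht lam = cfun.span (E ` perms n)" by (simp add: specht_def)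
  have "specht_char lam p = of_real (chi p)" if p: "p permutes {..<n}" for p
  proof -
    have "specht_char lam p = (\<Sum>q\<in>perms n. \<phi> q (perm_act p (E q)))"
      unfolding specht_char_def
    proof (rule trace_on_frame[OF linear_perm_act _ finite_perms V])
      show "v \<in> specht lam \<Longrightarrow> perm_act p v \<in> specht lam" for v
        using perm_act_specht[of p lam v] p n by simp
      show "\<phi> q (u + v) = \<phi> q u + \<phi> q v" for q u v
        by (simp add: \<phi>_def sum.distrib distrib_left)
      show "\<phi> q (cscale z v) = z * \<phi> q v" for q z v
        by (simp add: \<phi>_def cscale_def sum_distrib_left mult_ac)
    qed (rule frame)
    also have "\<dots> = (\<Sum>q\<in>perms n. of_real (coef (inv q \<circ> p \<circ> q) / norm_const))"
    proof (intro sum.cong refl)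
      fix q assume "q \<in> perms n"
      then have q: "q permutes {..<n}" by simp
      have "perm_act p (E q) = E (p \<circ> q)"
        using perm_act_polytabloid[of p lam "q \<circ> t"] p n by (simp add: E_def o_assoc)
      then show "\<phi> q (perm_act p (E q)) = of_real (coef (inv q \<circ> p \<circ> q) / norm_const)"
        by (simp add: phi_E p q permutes_compose o_assoc)
    qed
    also have "\<dots> = of_real (chi p)" by (simp add: chi_def sum_divide_distrib)
    finally show ?thesis .
  qed
  then show ?thesis by (rule that[OF F])
qed

section \<open>Completeness of the Specht characters\<close>

text \<open>The rows of the tableau are the cycles of \<open>p\<close>, sorted by decreasing length, and \<open>p\<close> moves each entry
  one step to the right cyclically.\<close>
lemma cycle_tableau:
  assumes p: "p permutes {..<n}"
  obtains lam t where "lam \<turnstile> n" "bij_betw t (diagram lam) {..<n}"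
    "\<And>i j. (i, j) \<in> diagram lam \<Longrightarrow> p (t (i, j)) = t (i, Suc j mod lam ! i)"
proof -
  have perm: "permutation p" using p permutes_imp_permutation by blast
  have self: "x \<in> orbit p x" for x by (rule permutation_self_in_orbit[OF perm])
  have orb_eq: "orbit p y = orbit p x" if "y \<in> orbit p x" for x y
    by (rule orbit_cyclic_eq3[OF cyclic_on_orbit'[OF perm] that])
  have orb_sub: "orbit p x \<subseteq> {..<n}" if "x < n" for x
    using permutes_orbit_subset[OF p] that by simp
  define m where "m x = funpow_dist1 p x x" for x
  have orb: "orbit p x = (\<lambda>j. (p ^^ j) x) ` {..<m x}" for x
    using orbit_conv_funpow_dist1[OF self] by (simp add: m_def atLeast0LessThan)
  have inj: "inj_on (\<lambda>j. (p ^^ j) x) {..<m x}" for x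
    using inj_on_funpow_dist1[OF self] by (simp add: m_def atLeast0LessThan)
  have ret: "(p ^^ m x) x = x" for x
    unfolding m_def by (rule funpow_dist1_prop[OF self])
  have card_orb: "card (orbit p x) = m x" for x
    unfolding orb using card_image[OF inj] by simp
  obtain os0 where os0: "set os0 = orbit p ` {..<n}" "distinct os0"
    using finite_distinct_list[of "orbit p ` {..<n}"] by auto
  define os where "os = rev (sort_key card os0)"
  have os: "set os = orbit p ` {..<n}" "distinct os" using os0 by (auto simp: os_def)
  have sorted_os: "sorted_wrt (\<ge>) (map card os)"
    by (simp add: os_def rev_map[symmetric] sorted_wrt_rev)
  define lam where "lam = map card os"
  have "\<exists>y. y < n \<and> os ! i = orbit p y" if "i < length os" for i
    using os(1) nth_mem[OF that] by auto
  then obtain x where x: "\<And>i. i < length os \<Longrightarrow> x i < n \<and> os ! i = orbit p (x i)" by metis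
  have lam_nth: "lam ! i = m (x i)" if "i < length os" for i
    using x[OF that] that by (simp add: lam_def card_orb)
  define t where "t = (\<lambda>(i, j). (p ^^ j) (x i))"
  have D: "(i, j) \<in> diagram lam \<longleftrightarrow> i < length os \<and> j < m (x i)" for i j
    using lam_nth by (auto simp: diagram_def) (simp_all add: lam_def)
  have t_orb: "t (i, j) \<in> orbit p (x i)" if "(i, j) \<in> diagram lam" for i j
    using that by (auto simp: D orb t_def)
  have bij: "bij_betw t (diagram lam) {..<n}"
  proof (rule bij_betw_imageI)
    show "inj_on t (diagram lam)"
    proof (rule inj_onI, clarify)
      fix i j i' j'
      assume ij: "(i, j) \<in> diagram lam" and ij': "(i', j') \<in> diagram lam" and eq: "t (i, j) = t (i', j')"
      have "orbit p (x i) = orbit p (x i')"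
        using orb_eq[OF t_orb[OF ij]] orb_eq[OF t_orb[OF ij']] eq by simp
      then have "os ! i = os ! i'" using x ij ij' by (auto simp: D)
      then have "i = i'" using os(2) ij ij' by (auto simp: D nth_eq_iff_index_eq)
      moreover from this have "j = j'" using inj_onD[OF inj[of "x i"], of j j'] eq ij ij' by (auto simp: D t_def)
      ultimately show "i = i' \<and> j = j'" by simp
    qed
    show "t ` diagram lam = {..<n}"
    proof (intro equalityI subsetI)
      fix y assume "y \<in> t ` diagram lam"
      then obtain i j where ij: "(i, j) \<in> diagram lam" "y = t (i, j)" by auto
      then have "x i < n" using x by (simp add: D)
      then show "y \<in> {..<n}" using t_orb[OF ij(1)] orb_sub ij(2) by blast
    next
      fix y assume "y \<in> {..<n}"
      then have "orbit p y \<in> set os" using os by auto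
      then obtain i where i: "i < length os" "os ! i = orbit p y" by (auto simp: in_set_conv_nth)
      then have "y \<in> orbit p (x i)" using x self[of y] by auto
      then obtain j where "j < m (x i)" "y = (p ^^ j) (x i)" by (auto simp: orb)
      then have "(i, j) \<in> diagram lam" "y = t (i, j)" using i by (auto simp: D t_def)
      then show "y \<in> t ` diagram lam" by blast
    qed
  qed
  have "sum_list lam = n"
    using bij_betw_same_card[OF bij] by (simp add: card_diagram)
  moreover have "0 \<notin> set lam"
    using os(1) by (auto simp: lam_def card_orb) (simp add: m_def)
  ultimately have "lam \<turnstile> n" using sorted_os by (simp add: is_partition_def lam_def)
  moreover have "p (t (i, j)) = t (i, Suc j mod lam ! i)" if "(i, j) \<in> diagram lam" for i j
  proof (cases "Suc j = m (x i)")
    case True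
    have "p (t (i, j)) = (p ^^ m (x i)) (x i)" by (simp add: t_def True[symmetric])
    then show ?thesis using True that by (simp add: t_def ret lam_nth D)
  next
    case False
    then show ?thesis using that by (simp add: t_def lam_nth D)
  qed
  ultimately show ?thesis using that bij by blast
qed

text \<open>The shape of some cycle tableau of \<open>p\<close>. It is a partition of \<open>n\<close>, and by \<open>cycle_type_conj\<close> it
  separates conjugacy classes, so there are at most as many classes as partitions.\<close>
definition cycle_type :: "nat \<Rightarrow> (nat \<Rightarrow> nat) \<Rightarrow> nat list" where
  "cycle_type n p = (SOME lam. lam \<turnstile> n \<and> (\<exists>t. bij_betw t (diagram lam) {..<n} \<and>
     (\<forall>i j. (i, j) \<in> diagram lam \<longrightarrow> p (t (i, j)) = t (i, Suc j mod lam ! i))))"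

lemma cycle_type:
  assumes p: "p permutes {..<n}"
  shows "cycle_type n p \<turnstile> n \<and> (\<exists>t. bij_betw t (diagram (cycle_type n p)) {..<n} \<and>
     (\<forall>i j. (i, j) \<in> diagram (cycle_type n p) \<longrightarrow> p (t (i, j)) = t (i, Suc j mod cycle_type n p ! i)))"
proof -
  obtain lam t where "lam \<turnstile> n" "bij_betw t (diagram lam) {..<n}"
    "\<And>i j. (i, j) \<in> diagram lam \<Longrightarrow> p (t (i, j)) = t (i, Suc j mod lam ! i)"
    using cycle_tableau[OF p] by metis
  then have "\<exists>lam. lam \<turnstile> n \<and> (\<exists>t. bij_betw t (diagram lam) {..<n} \<and>
     (\<forall>i j. (i, j) \<in> diagram lam \<longrightarrow> p (t (i, j)) = t (i, Suc j mod lam ! i)))" by blast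
  from someI_ex[OF this] show ?thesis unfolding cycle_type_def .
qed

text \<open>The bijection between two cycle tableaux of the same shape intertwines the two permutations.\<close>
lemma cycle_type_conj:
  assumes p: "p permutes {..<n}" and q: "q permutes {..<n}" and eq: "cycle_type n p = cycle_type n q"
  obtains g where "g permutes {..<n}" "p = inv g \<circ> q \<circ> g"
proof -
  define lam where "lam = cycle_type n p"
  have lam_q: "lam = cycle_type n q" using eq lam_def by simp
  obtain t where t: "bij_betw t (diagram lam) {..<n}"
    "\<And>i j. (i, j) \<in> diagram lam \<Longrightarrow> p (t (i, j)) = t (i, Suc j mod lam ! i)"
    using cycle_type[OF p] unfolding lam_def by blast
  obtain s where s: "bij_betw s (diagram lam) {..<n}"
    "\<And>i j. (i, j) \<in> diagram lam \<Longrightarrow> q (s (i, j)) = s (i, Suc j mod lam ! i)"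
    using cycle_type[OF q] unfolding lam_q by blast
  define u where "u = inv_into (diagram lam) t"
  have u: "bij_betw u {..<n} (diagram lam)" unfolding u_def by (rule bij_betw_inv_into[OF t(1)])
  have ut: "u (t x) = x" if "x \<in> diagram lam" for x
    using that t(1) by (simp add: u_def bij_betw_def)
  have tn: "t x < n" if "x \<in> diagram lam" for x using bij_betwE[OF t(1)] that by auto
  define g where "g = (\<lambda>x. if x < n then s (u x) else x)"
  have "bij_betw (s \<circ> u) {..<n} {..<n}" using u s(1) by (rule bij_betw_trans)
  then have "bij_betw g {..<n} {..<n}" by (rule bij_betw_cong[THEN iffD1, rotated]) (simp add: g_def)
  then have g: "g permutes {..<n}" by (rule bij_imp_permutes) (simp add: g_def)
  have gt: "g (t x) = s x" if "x \<in> diagram lam" for x using that by (simp add: g_def tn ut)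
  have "g \<circ> p = q \<circ> g"
  proof
    fix y
    show "(g \<circ> p) y = (q \<circ> g) y"
    proof (cases "y < n")
      case True
      then have "y \<in> t ` diagram lam" using t(1) by (simp add: bij_betw_def)
      then obtain i j where ij: "(i, j) \<in> diagram lam" "y = t (i, j)" by auto
      then have "(i, Suc j mod lam ! i) \<in> diagram lam" by (auto simp: diagram_def)
      then show ?thesis using ij by (simp add: t(2) s(2) gt)
    next
      case False
      then show ?thesis using p q g by (simp add: permutes_def)
    qed
  qed
  then have "p = inv g \<circ> q \<circ> g" using perm_inv_cancel(3)[OF g, of p] by (simp add: o_assoc)
  with g show ?thesis by (rule that)
qed

lemma finite_partitions: "finite {lam. lam \<turnstile> n}"
proof (rule finite_subset)
  have "length lam \<le> sum_list lam" if "0 \<notin> set lam" for lam :: "nat list"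
    using that by (induction lam) auto
  then show "{lam. lam \<turnstile> n} \<subseteq> {xs. set xs \<subseteq> {..n} \<and> length xs \<le> n}"
    by (auto simp: is_partition_def intro: member_le_sum_list)
  show "finite {xs. set xs \<subseteq> {..n} \<and> length xs \<le> n}" by (rule finite_lists_length_le) simp
qed

lemma orthogonal_independent:
  fixes S :: "('a \<Rightarrow> complex) set"
  assumes fin: "finite S"
    and orth: "\<And>u v. u \<in> S \<Longrightarrow> v \<in> S \<Longrightarrow> u \<noteq> v \<Longrightarrow> (\<Sum>p\<in>P. u p * v p) = 0"
    and nz: "\<And>u. u \<in> S \<Longrightarrow> (\<Sum>p\<in>P. u p * u p) \<noteq> 0"
  shows "cfun.independent S"
proof (rule cfun.independent_if_scalars_zero[OF fin])
  fix f v assume z: "(\<Sum>u\<in>S. cscale (f u) u) = 0" and v: "v \<in> S"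
  have "0 = (\<Sum>p\<in>P. (\<Sum>u\<in>S. cscale (f u) u) p * v p)" by (simp add: z)
  also have "\<dots> = (\<Sum>p\<in>P. \<Sum>u\<in>S. f u * (u p * v p))"
    by (simp add: sum_fun_apply cscale_def sum_distrib_right mult.assoc)
  also have "\<dots> = (\<Sum>u\<in>S. f u * (\<Sum>p\<in>P. u p * v p))"
    by (subst sum.swap) (simp add: sum_distrib_left)
  also have "\<dots> = (\<Sum>u\<in>{v}. f u * (\<Sum>p\<in>P. u p * v p))"
    by (rule sum.mono_neutral_right) (use fin v orth in auto)
  finally show "f v = 0" using nz[OF v] by simp
qed

text \<open>An orthogonal family with at least as many members as there are classes spans the class functions:
  the error of the expansion is orthogonal to the family, and were it nonzero, there would be more
  independent class functions than indicator functions of classes.\<close>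
lemma class_function_expansion:
  fixes \<chi> :: "'c \<Rightarrow> 'b \<Rightarrow> real" and ty :: "'b \<Rightarrow> 'c"
  assumes P: "finite P" and L: "finite L" and ty: "ty ` P \<subseteq> L" and N: "N > 0"
    and orth: "\<And>l l'. l \<in> L \<Longrightarrow> l' \<in> L \<Longrightarrow> (\<Sum>p\<in>P. \<chi> l p * \<chi> l' p) = (if l = l' then N else 0)"
    and cls: "\<And>l p q. l \<in> L \<Longrightarrow> p \<in> P \<Longrightarrow> q \<in> P \<Longrightarrow> ty p = ty q \<Longrightarrow> \<chi> l p = \<chi> l q"
    and f: "\<And>p q. p \<in> P \<Longrightarrow> q \<in> P \<Longrightarrow> ty p = ty q \<Longrightarrow> f p = f q"
    and p0: "p0 \<in> P"
  shows "f p0 = (\<Sum>l\<in>L. (\<Sum>q\<in>P. f q * \<chi> l q) / N * \<chi> l p0)"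
proof (rule ccontr)
  assume ne: "\<not> ?thesis"
  define m where "m l = (\<Sum>q\<in>P. f q * \<chi> l q) / N" for l
  define g where "g p = f p - (\<Sum>l\<in>L. m l * \<chi> l p)" for p
  have g0: "g p0 \<noteq> 0" using ne by (simp add: g_def m_def)
  have g_class: "g p = g q" if "p \<in> P" "q \<in> P" "ty p = ty q" for p q
    using f[OF that] cls[OF _ that] by (simp add: g_def)
  have g_orth: "(\<Sum>p\<in>P. g p * \<chi> l p) = 0" if l: "l \<in> L" for l
  proof -
    have "(\<Sum>p\<in>P. (\<Sum>l'\<in>L. m l' * \<chi> l' p) * \<chi> l p) = (\<Sum>l'\<in>L. m l' * (\<Sum>p\<in>P. \<chi> l' p * \<chi> l p))"
      unfolding sum_distrib_left sum_distrib_right by (subst sum.swap) (simp add: mult.assoc)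
    also have "\<dots> = (\<Sum>l'\<in>L. if l' = l then m l * N else 0)"
      by (intro sum.cong refl) (simp add: orth l)
    also have "\<dots> = (\<Sum>q\<in>P. f q * \<chi> l q)" using l L N by (simp add: m_def)
    finally show ?thesis by (simp add: g_def left_diff_distrib sum_subtractf)
  qed
  define X where "X l = (\<lambda>p. if p \<in> P then complex_of_real (\<chi> l p) else 0)" for l
  define G where "G = (\<lambda>p. if p \<in> P then complex_of_real (g p) else 0)"
  define I where "I l = (\<lambda>p. if p \<in> P \<and> ty p = l then 1 :: complex else 0)" for l
  have XX: "(\<Sum>p\<in>P. X l p * X l' p) = (if l = l' then of_real N else 0)" if "l \<in> L" "l' \<in> L" for l l'
  proof -
    have "(\<Sum>p\<in>P. X l p * X l' p) = of_real (\<Sum>p\<in>P. \<chi> l p * \<chi> l' p)"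
      unfolding of_real_sum by (intro sum.cong refl) (simp add: X_def)
    then show ?thesis by (simp add: orth that)
  qed
  have GX: "(\<Sum>p\<in>P. G p * X l p) = 0" if "l \<in> L" for l
  proof -
    have "(\<Sum>p\<in>P. G p * X l p) = of_real (\<Sum>p\<in>P. g p * \<chi> l p)"
      unfolding of_real_sum by (intro sum.cong refl) (simp add: X_def G_def)
    then show ?thesis by (simp add: g_orth that)
  qed
  have GG: "(\<Sum>p\<in>P. G p * G p) \<noteq> 0"
  proof -
    have "(\<Sum>p\<in>P. G p * G p) = of_real (\<Sum>p\<in>P. g p * g p)"
      unfolding of_real_sum by (intro sum.cong refl) (simp add: G_def)
    moreover have "(\<Sum>p\<in>P. g p * g p) > 0"
      by (rule sum_pos2[OF P p0]) (use g0 in \<open>auto simp: not_square_less_zero zero_less_mult_iff linorder_neq_iff\<close>)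
    ultimately show ?thesis by (metis less_irrefl of_real_eq_0_iff)
  qed
  have injX: "inj_on X L"
    by (rule inj_onI) (metis XX N less_irrefl of_real_eq_0_iff)
  have GnX: "G \<notin> X ` L" using GX GG by auto
  let ?S = "insert G (X ` L)"
  have ind: "cfun.independent ?S"
  proof (rule orthogonal_independent[where P = P])
    show "finite ?S" using L by simp
    show "(\<Sum>p\<in>P. u p * v p) = 0" if "u \<in> ?S" "v \<in> ?S" "u \<noteq> v" for u v
      using that XX GX by (auto simp: mult.commute[of _ "G _"] split: if_splits)
    show "(\<Sum>p\<in>P. u p * u p) \<noteq> 0" if "u \<in> ?S" for u
      using that XX GG N by auto
  qed
  have sp: "v \<in> cfun.span (I ` (ty ` P))" if "\<And>p q. p \<in> P \<Longrightarrow> q \<in> P \<Longrightarrow> ty p = ty q \<Longrightarrow> v p = v q"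
     and "\<And>p. p \<notin> P \<Longrightarrow> v p = 0" for v
  proof -
    have "v = (\<Sum>l\<in>ty ` P. cscale (v (inv_into P ty l)) (I l))"
    proof
      fix p
      show "v p = (\<Sum>l\<in>ty ` P. cscale (v (inv_into P ty l)) (I l)) p"
      proof (cases "p \<in> P")
        case True
        have "(\<Sum>l\<in>ty ` P. cscale (v (inv_into P ty l)) (I l)) p = (\<Sum>l\<in>ty ` P. if l = ty p then v (inv_into P ty l) else 0)"
          unfolding sum_fun_apply by (intro sum.cong refl) (auto simp: cscale_def I_def True)
        also have "\<dots> = v (inv_into P ty (ty p))" using P True by (simp add: sum.delta)
        also have "\<dots> = v p" by (rule that(1)) (use True in \<open>auto simp: inv_into_into f_inv_into_f\<close>)
        finally show ?thesis by simp
      next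
        case False
        then show ?thesis by (simp add: sum_fun_apply cscale_def I_def that(2))
      qed
    qed
    also have "\<dots> \<in> cfun.span (I ` (ty ` P))"
      by (intro cfun.span_sum cfun.span_scale cfun.span_base) auto
    finally show ?thesis .
  qed
  have sub: "?S \<subseteq> cfun.span (I ` (ty ` P))"
  proof -
    have "G \<in> cfun.span (I ` (ty ` P))"
    proof (rule sp)
      show "G p = G q" if "p \<in> P" "q \<in> P" "ty p = ty q" for p q
        using g_class[OF that] that by (simp add: G_def)
    qed (simp add: G_def)
    moreover have "X l \<in> cfun.span (I ` (ty ` P))" if "l \<in> L" for l
    proof (rule sp)
      show "X l p = X l q" if "p \<in> P" "q \<in> P" "ty p = ty q" for p q
        using cls[OF \<open>l \<in> L\<close> that] that by (simp add: X_def)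
    qed (simp add: X_def)
    ultimately show ?thesis by blast
  qed
  have "card ?S \<le> card (I ` (ty ` P))"
    by (rule cfun.independent_span_bound[OF _ ind sub, THEN conjunct2]) (use P in simp)
  also have "\<dots> \<le> card (ty ` P)" by (rule card_image_le) (use P in simp)
  also have "\<dots> \<le> card L" by (rule card_mono[OF L ty])
  also have "\<dots> < card ?S" using L GnX by (simp add: card_image[OF injX])
  finally show False by simp
qed

section \<open>Counting words fixed by permutations\<close>

abbreviation words :: "nat \<Rightarrow> 'a set \<Rightarrow> (nat \<Rightarrow> 'a) set" where
  "words n A \<equiv> {..<n} \<rightarrow>\<^sub>E A"

text \<open>The character of \<open>S\<^sub>n\<close> on the linear span of the words of length \<open>n\<close> over \<open>A\<close>.\<close>
definition fixed_words :: "nat \<Rightarrow> 'a set \<Rightarrow> (nat \<Rightarrow> nat) \<Rightarrow> real" where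
  "fixed_words n A p = (\<Sum>w\<in>words n A. of_bool (p \<in> fiber_stab n w))"

lemma finite_words: "finite A \<Longrightarrow> finite (words n A)"
  by (simp add: finite_PiE)

lemma words_comp: "p permutes {..<n} \<Longrightarrow> w \<in> words n A \<Longrightarrow> w \<circ> p \<in> words n A"
  by (auto simp: PiE_iff extensional_def permutes_less)

lemma word_stab_iff:
  assumes "p permutes {..<n}" "w \<in> words n A"
  shows "p \<in> fiber_stab n w \<longleftrightarrow> w \<circ> p = w"
proof
  assume "p \<in> fiber_stab n w"
  then show "w \<circ> p = w" using assms
    by (intro ext) (auto simp: fiber_stab_def PiE_iff extensional_def permutes_less split: if_splits, metis permutes_not_in lessThan_iff)
next
  assume "w \<circ> p = w"
  then show "p \<in> fiber_stab n w" using assms(1) by (auto simp: fiber_stab_def fun_eq_iff)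
qed

lemma fixed_words_class:
  assumes p: "p permutes {..<n}" and g: "g permutes {..<n}"
  shows "fixed_words n A (inv g \<circ> p \<circ> g) = fixed_words n A p"
  unfolding fixed_words_def
proof (rule sum.reindex_bij_witness[where i = "\<lambda>w. w \<circ> g" and j = "\<lambda>w. w \<circ> inv g"])
  fix w assume w: "w \<in> words n A"
  have ig: "inv g permutes {..<n}" using g by (rule permutes_inv)
  have w': "w \<circ> inv g \<in> words n A" by (rule words_comp[OF ig w])
  have "w \<circ> (inv g \<circ> p \<circ> g) = w \<longleftrightarrow> (w \<circ> inv g) \<circ> p = w \<circ> inv g"
  proof
    assume "w \<circ> (inv g \<circ> p \<circ> g) = w"
    then have "w \<circ> (inv g \<circ> p \<circ> g) \<circ> inv g = w \<circ> inv g" by simp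
    then show "(w \<circ> inv g) \<circ> p = w \<circ> inv g" by (simp add: o_assoc[symmetric] perm_inv_cancel[OF g])
  next
    assume "(w \<circ> inv g) \<circ> p = w \<circ> inv g"
    then have "(w \<circ> inv g) \<circ> p \<circ> g = w \<circ> inv g \<circ> g" by simp
    then show "w \<circ> (inv g \<circ> p \<circ> g) = w" by (simp add: o_assoc[symmetric] perm_inv_cancel[OF g])
  qed
  then show "(of_bool (p \<in> fiber_stab n (w \<circ> inv g)) :: real) = of_bool (inv g \<circ> p \<circ> g \<in> fiber_stab n w)"
    using word_stab_iff[OF p w'] word_stab_iff[OF _ w, of "inv g \<circ> p \<circ> g"] p g ig by (simp add: permutes_compose)
qed (simp_all add: words_comp[OF g] words_comp[OF permutes_inv[OF g]] o_assoc[symmetric] perm_inv_cancel[OF g])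

lemma fixed_words_Times:
  "fixed_words n (A \<times> B) p = fixed_words n A p * fixed_words n B p"
proof -
  have "fixed_words n A p * fixed_words n B p =
    (\<Sum>(u, v)\<in>words n A \<times> words n B. of_bool (p \<in> fiber_stab n u) * of_bool (p \<in> fiber_stab n v))"
    unfolding fixed_words_def by (simp add: sum_product sum.cartesian_product)
  also have "\<dots> = fixed_words n (A \<times> B) p"
    unfolding fixed_words_def
  proof (rule sum.reindex_bij_witness[where
      i = "\<lambda>w. (restrict (fst \<circ> w) {..<n}, restrict (snd \<circ> w) {..<n})"
      and j = "\<lambda>(u, v). restrict (\<lambda>x. (u x, v x)) {..<n}"])
    fix uv assume "uv \<in> words n A \<times> words n B"
    then obtain u v where uv: "uv = (u, v)" "u \<in> words n A" "v \<in> words n B" by auto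
    show "(restrict (fst \<circ> (case uv of (u, v) \<Rightarrow> restrict (\<lambda>x. (u x, v x)) {..<n})) {..<n},
         restrict (snd \<circ> (case uv of (u, v) \<Rightarrow> restrict (\<lambda>x. (u x, v x)) {..<n})) {..<n}) = uv"
      using uv by (auto simp: fun_eq_iff PiE_iff extensional_def restrict_def)
    show "(case uv of (u, v) \<Rightarrow> restrict (\<lambda>x. (u x, v x)) {..<n}) \<in> words n (A \<times> B)"
      using uv by (auto simp: PiE_iff)
    show "(of_bool (p \<in> fiber_stab n (case uv of (u, v) \<Rightarrow> restrict (\<lambda>x. (u x, v x)) {..<n})) :: real) =
       (case uv of (u, v) \<Rightarrow> of_bool (p \<in> fiber_stab n u) * of_bool (p \<in> fiber_stab n v))"
    proof -
      have "p \<in> fiber_stab n (restrict (\<lambda>x. (u x, v x)) {..<n}) \<longleftrightarrow> p \<in> fiber_stab n u \<and> p \<in> fiber_stab n v"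
        unfolding fiber_stab_def by (auto simp: permutes_less)
      then show ?thesis by (simp add: uv(1) of_bool_conj)
    qed
  next
    fix w assume w: "w \<in> words n (A \<times> B)"
    then show "(case (restrict (fst \<circ> w) {..<n}, restrict (snd \<circ> w) {..<n}) of (u, v) \<Rightarrow> restrict (\<lambda>x. (u x, v x)) {..<n}) = w"
      by (auto simp: fun_eq_iff PiE_iff extensional_def restrict_def)
    show "(restrict (fst \<circ> w) {..<n}, restrict (snd \<circ> w) {..<n}) \<in> words n A \<times> words n B"
      using w by (auto simp: PiE_iff mem_Times_iff)
  qed
  finally show ?thesis ..
qed

text \<open>How often each letter of the alphabet \<open>as\<close> occurs in \<open>w\<close>; two words lie in the same \<open>S\<^sub>n\<close>-orbit iff
  their contents agree.\<close>
definition content :: "nat \<Rightarrow> 'a list \<Rightarrow> (nat \<Rightarrow> 'a) \<Rightarrow> nat list" where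
  "content n as w = map (\<lambda>a. card {x. x < n \<and> w x = a}) as"

lemma content_comp:
  assumes "p permutes {..<n}"
  shows "content n as (w \<circ> p) = content n as w"
  using card_perm_less[OF assms, of "\<lambda>x. w x = _"] by (simp add: content_def)

lemma content_eq:
  assumes u: "u \<in> words n (set as)" and v: "v \<in> words n (set as)" and eq: "content n as u = content n as v"
  obtains g where "g permutes {..<n}" "u = v \<circ> g"
proof -
  have "card {x \<in> {..<n}. u x = a} = card {x \<in> {..<n}. v x = a}" for a
  proof (cases "a \<in> set as")
    case True
    then show ?thesis using eq by (auto simp: content_def)
  next
    case False
    then have "{x \<in> {..<n}. u x = a} = {}" "{x \<in> {..<n}. v x = a} = {}" using u v by auto
    then show ?thesis by (simp only:)
  qed
  then have "image_mset u (mset_set {..<n}) = image_mset v (mset_set {..<n})"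
    by (intro multiset_eqI) (simp add: count_image_mset_eq_card_vimage)
  then obtain g where g: "g permutes {..<n}" "\<forall>x\<in>{..<n}. u x = v (g x)"
    by (rule image_mset_eq_implies_permutes[rotated]) auto
  have "u = v \<circ> g"
  proof (rule extensionalityI[where A = "{..<n}"])
    show "v \<circ> g \<in> extensional {..<n}" using words_comp[OF g(1) v] by (auto simp: PiE_iff)
  qed (use u g in \<open>auto simp: PiE_iff\<close>)
  with g(1) show ?thesis by (rule that)
qed

lemma sum_list_content:
  assumes w: "w \<in> words n (set as)" and d: "distinct as"
  shows "sum_list (content n as w) = n"
proof -
  have "sum_list (content n as w) = (\<Sum>a\<in>set as. card {x. x < n \<and> w x = a})"
    unfolding content_def by (rule sum_list_distinct_conv_sum_set[OF d])
  also have "\<dots> = (\<Sum>a\<in>set as. \<Sum>x\<in>{x \<in> {..<n}. w x = a}. 1)" by simp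
  also have "\<dots> = (\<Sum>x<n. 1)" by (rule sum.group) (use w in auto)
  finally show ?thesis by simp
qed

text \<open>The rows of the diagram of \<open>l\<close>, which need not be a partition, have the required letter counts as
  their lengths, so any enumeration of the cells gives such a word.\<close>
lemma content_surj:
  assumes d: "distinct as" and l: "length l = length as" "sum_list l = n"
  obtains w where "w \<in> words n (set as)" "content n as w = l"
proof -
  have "card (diagram l) = n" by (simp add: card_diagram l)
  then obtain h where h: "bij_betw h {..<n} (diagram l)"
    using finite_same_card_bij[OF _ finite_diagram, of "{..<n}" l] by auto
  define w where "w = restrict (\<lambda>x. as ! fst (h x)) {..<n}"
  have hD: "fst (h x) < length as" if "x < n" for x
    using bspec[OF bij_betwE[OF h], of x] that l(1) by (auto simp: diagram_def case_prod_beta)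
  have "w \<in> words n (set as)" using hD by (auto simp: w_def)
  moreover have "card {x. x < n \<and> w x = as ! i} = l ! i" if i: "i < length as" for i
  proof -
    have "bij_betw h {x. x < n \<and> w x = as ! i} {p \<in> diagram l. fst p = i}"
    proof (rule bij_betw_subset[OF h])
      show "h ` {x. x < n \<and> w x = as ! i} = {p \<in> diagram l. fst p = i}"
      proof (intro equalityI subsetI)
        fix p assume p: "p \<in> {p \<in> diagram l. fst p = i}"
        then obtain x where "x < n" "p = h x" using bij_betw_imp_surj_on[OF h] by blast
        then show "p \<in> h ` {x. x < n \<and> w x = as ! i}" using p by (auto simp: w_def)
      next
        fix p assume "p \<in> h ` {x. x < n \<and> w x = as ! i}"
        then obtain x where x: "x < n" "p = h x" "as ! fst (h x) = as ! i" by (auto simp: w_def)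
        then show "p \<in> {p \<in> diagram l. fst p = i}"
          using bij_betwE[OF h] hD[OF x(1)] i d by (auto simp: nth_eq_iff_index_eq)
      qed
    qed auto
    then have "card {x. x < n \<and> w x = as ! i} = card {p \<in> diagram l. fst p = i}" by (rule bij_betw_same_card)
    also have "{p \<in> diagram l. fst p = i} = {i} \<times> {..<l ! i}" using i l(1) by (auto simp: diagram_def)
    finally show ?thesis by simp
  qed
  then have "content n as w = l" by (intro nth_equalityI) (auto simp: content_def l(1))
  ultimately show ?thesis by (rule that)
qed

text \<open>Burnside's lemma: the sum counts pairs of a word and a permutation fixing it, and each orbit
  contributes \<open>n!\<close>. The orbits correspond to the contents, which are the ways of writing \<open>n\<close> as an
  ordered sum of \<open>card A\<close> nonnegative integers.\<close>
lemma sum_fixed_words: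
  assumes "finite A"
  shows "(\<Sum>p\<in>perms n. fixed_words n A p) = fact n * real ((n + card A - 1) choose n)"
proof -
  obtain as where as: "set as = A" "distinct as" using finite_distinct_list[OF assms] by blast
  let ?W = "words n A"
  have finW: "finite ?W" by (rule finite_words[OF assms])
  have stab: "card (fiber_stab n w) = card {p \<in> perms n. w0 \<circ> p = w}"
    if w: "w \<in> ?W" and w0: "w0 \<in> ?W" and c: "content n as w = content n as w0" for w w0
  proof -
    obtain g where g: "g permutes {..<n}" "w = w0 \<circ> g"
      using content_eq[OF _ _ c] w w0 as(1) by blast
    have "bij_betw (\<lambda>p. g \<circ> p) (fiber_stab n w) {p \<in> perms n. w0 \<circ> p = w}"
    proof (rule bij_betw_byWitness[where f' = "\<lambda>p. inv g \<circ> p"])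
      show "(\<lambda>p. g \<circ> p) ` fiber_stab n w \<subseteq> {p \<in> perms n. w0 \<circ> p = w}"
      proof (intro image_subsetI)
        fix p assume p: "p \<in> fiber_stab n w"
        then have "p permutes {..<n}" by (simp add: fiber_stab_def)
        then show "g \<circ> p \<in> {p \<in> perms n. w0 \<circ> p = w}"
          using p g word_stab_iff[OF _ w] by (simp add: permutes_compose o_assoc)
      qed
      show "(\<lambda>p. inv g \<circ> p) ` {p \<in> perms n. w0 \<circ> p = w} \<subseteq> fiber_stab n w"
      proof (intro image_subsetI)
        fix p assume p: "p \<in> {p \<in> perms n. w0 \<circ> p = w}"
        have "w \<circ> (inv g \<circ> p) = w" using p by (simp add: g(2) o_assoc[symmetric] perm_inv_cancel[OF g(1)])
        then show "inv g \<circ> p \<in> fiber_stab n w"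
          using p g(1) word_stab_iff[OF _ w] by (simp add: permutes_compose permutes_inv)
      qed
    qed (auto simp: perm_inv_cancel[OF g(1)])
    then show ?thesis by (rule bij_betw_same_card)
  qed
  have orb: "(\<Sum>w\<in>{w \<in> ?W. content n as w = l}. card (fiber_stab n w)) = fact n"
    if l: "l \<in> content n as ` ?W" for l
  proof -
    obtain w0 where w0: "w0 \<in> ?W" "l = content n as w0" using l by auto
    have "(\<Sum>w\<in>{w \<in> ?W. content n as w = l}. card (fiber_stab n w)) =
      (\<Sum>w\<in>{w \<in> ?W. content n as w = l}. \<Sum>p\<in>{p \<in> perms n. w0 \<circ> p = w}. 1)"
      by (intro sum.cong refl) (use stab w0 in auto)
    also have "\<dots> = (\<Sum>p\<in>perms n. 1)"
    proof (rule sum.group)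
      show "(\<lambda>p. w0 \<circ> p) ` perms n \<subseteq> {w \<in> ?W. content n as w = l}"
        using w0 by (intro image_subsetI) (simp add: words_comp content_comp)
    qed (use finW in \<open>simp_all add: finite_perms\<close>)
    finally show ?thesis by (simp add: card_permutations[OF refl])
  qed
  have "(\<Sum>p\<in>perms n. fixed_words n A p) = (\<Sum>w\<in>?W. \<Sum>p\<in>perms n. of_bool (p \<in> fiber_stab n w))"
    unfolding fixed_words_def by (rule sum.swap)
  also have "\<dots> = (\<Sum>w\<in>?W. real (card (fiber_stab n w)))"
  proof (rule sum.cong[OF refl])
    fix w :: "nat \<Rightarrow> 'a"
    have "{p. p permutes {..<n} \<and> p \<in> fiber_stab n w} = fiber_stab n w" by (auto simp: fiber_stab_def)
    then show "(\<Sum>p\<in>perms n. of_bool (p \<in> fiber_stab n w)) = real (card (fiber_stab n w))"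
      by (simp add: finite_perms of_bool_def sum.If_cases Collect_conj_eq[symmetric] Int_def)
  qed
  also have "\<dots> = real (\<Sum>w\<in>?W. card (fiber_stab n w))" by simp
  also have "(\<Sum>w\<in>?W. card (fiber_stab n w)) =
      (\<Sum>l\<in>content n as ` ?W. \<Sum>w\<in>{w \<in> ?W. content n as w = l}. card (fiber_stab n w))"
    by (rule sum.image_gen[OF finW])
  also have "\<dots> = card (content n as ` ?W) * fact n" by (simp add: orb)
  also have "content n as ` ?W = {l. length l = card A \<and> sum_list l = n}"
  proof (intro equalityI subsetI)
    fix l assume "l \<in> {l. length l = card A \<and> sum_list l = n}"
    then show "l \<in> content n as ` ?W"
      using content_surj[OF as(2), of l n] as distinct_card[OF as(2)] by (auto simp: image_iff) metis
  next
    fix l assume "l \<in> content n as ` ?W"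
    then obtain w where "w \<in> ?W" "l = content n as w" by auto
    then show "l \<in> {l. length l = card A \<and> sum_list l = n}"
      using as distinct_card[OF as(2)] sum_list_content[of w n as] by (simp add: content_def)
  qed
  also have "card \<dots> = (n + card A - 1) choose n" by (rule card_length_sum_list)
  finally show ?thesis by simp
qed

section \<open>Multiplicities of Specht modules in words\<close>

definition rchar :: "nat list \<Rightarrow> (nat \<Rightarrow> nat) \<Rightarrow> real" where
  "rchar lam p = Re (specht_char lam p)"

lemma rchar_young:
  assumes "lam \<turnstile> n"
  obtains r c where "filling n lam r c"
    "\<And>p. p permutes {..<n} \<Longrightarrow> rchar lam p = young.chi n (fiber_stab n r) (fiber_stab n c) p"
  using specht_char_young[OF assms] by (metis Re_complex_of_real rchar_def)

lemma specht_char_rchar: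
  assumes "lam \<turnstile> n" "p permutes {..<n}"
  shows "specht_char lam p = of_real (rchar lam p)"
  using specht_char_young[OF assms(1)] assms(2) by (metis Re_complex_of_real rchar_def)

lemma rchar_orth:
  assumes lam: "lam \<turnstile> n" and mu: "mu \<turnstile> n"
  shows "(\<Sum>p\<in>perms n. rchar lam p * rchar mu p) = (if lam = mu then fact n else 0)"
proof -
  obtain r c where rc: "filling n lam r c"
    "\<And>p. p permutes {..<n} \<Longrightarrow> rchar lam p = young.chi n (fiber_stab n r) (fiber_stab n c) p"
    using rchar_young[OF lam] by metis
  obtain r' c' where rc': "filling n mu r' c'"
    "\<And>p. p permutes {..<n} \<Longrightarrow> rchar mu p = young.chi n (fiber_stab n r') (fiber_stab n c') p"
    using rchar_young[OF mu] by metis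
  show ?thesis
  proof (cases "lam = mu")
    case True
    then show ?thesis using young.chi_norm[OF young_filling[OF rc(1)]] rc(2) by simp
  next
    case False
    then show ?thesis using filling_chi_orthogonal[OF rc(1) rc'(1)] rc(2) rc'(2) by simp
  qed
qed

lemma rchar_cycle_type:
  assumes lam: "lam \<turnstile> n" and p: "p permutes {..<n}" and q: "q permutes {..<n}" and eq: "cycle_type n p = cycle_type n q"
  shows "rchar lam p = rchar lam q"
proof -
  obtain r c where rc: "filling n lam r c"
    "\<And>p. p permutes {..<n} \<Longrightarrow> rchar lam p = young.chi n (fiber_stab n r) (fiber_stab n c) p"
    using rchar_young[OF lam] by metis
  obtain g where "g permutes {..<n}" "p = inv g \<circ> q \<circ> g" using cycle_type_conj[OF p q eq] by blast
  then show ?thesis using young.chi_class[OF young_filling[OF rc(1)] q] rc(2)[OF p] rc(2)[OF q] by simp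
qed

text \<open>The multiplicity of the Specht module in the permutation module of words over \<open>A\<close>, as a character inner
  product.\<close>
definition word_mult :: "nat \<Rightarrow> 'a set \<Rightarrow> nat list \<Rightarrow> real" where
  "word_mult n A lam = (\<Sum>p\<in>perms n. fixed_words n A p * rchar lam p) / fact n"

text \<open>Summing over the fixed words of each permutation amounts to summing over the stabiliser of each
  word, so the multiplicity is a sum of multiplicities of trivial characters of these stabilisers.\<close>
lemma word_mult_stab:
  assumes F: "filling n lam r c"
    and chi: "\<And>p. p permutes {..<n} \<Longrightarrow> rchar lam p = young.chi n (fiber_stab n r) (fiber_stab n c) p"
  shows "word_mult n A lam = (\<Sum>w\<in>words n A. \<Sum>p\<in>fiber_stab n w. young_base.coef (fiber_stab n r) (fiber_stab n c) p)
     / young.norm_const n (fiber_stab n r) (fiber_stab n c)"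
proof -
  interpret young n "fiber_stab n r" "fiber_stab n c" by (rule young_filling[OF F])
  have stab: "(\<Sum>p\<in>fiber_stab n w. coef p) = (\<Sum>p\<in>perms n. coef p * of_bool (p \<in> fiber_stab n w))" for w :: "nat \<Rightarrow> 'a"
  proof -
    have "(\<Sum>p\<in>fiber_stab n w. coef p) = (\<Sum>p\<in>fiber_stab n w. coef p * of_bool (p \<in> fiber_stab n w))" by simp
    also have "\<dots> = (\<Sum>p\<in>perms n. coef p * of_bool (p \<in> fiber_stab n w))"
      by (rule sum.mono_neutral_left) (auto simp: finite_perms fiber_stab_def)
    finally show ?thesis .
  qed
  have "(\<Sum>p\<in>perms n. fixed_words n A p * rchar lam p) = (\<Sum>p\<in>perms n. chi p * fixed_words n A p)"
    by (intro sum.cong refl) (simp add: chi mult.commute)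
  also have "\<dots> = fact n / norm_const * (\<Sum>p\<in>perms n. coef p * fixed_words n A p)"
    by (rule sum_chi_class_fun) (rule fixed_words_class)
  also have "(\<Sum>p\<in>perms n. coef p * fixed_words n A p) = (\<Sum>w\<in>words n A. \<Sum>p\<in>fiber_stab n w. coef p)"
    unfolding stab fixed_words_def sum_distrib_left by (rule sum.swap)
  finally show ?thesis by (simp add: word_mult_def)
qed

lemma word_mult_nonneg:
  assumes lam: "lam \<turnstile> n"
  shows "word_mult n A lam \<ge> 0"
proof -
  obtain r c where rc: "filling n lam r c"
    "\<And>p. p permutes {..<n} \<Longrightarrow> rchar lam p = young.chi n (fiber_stab n r) (fiber_stab n c) p"
    using rchar_young[OF lam] by metis
  interpret young n "fiber_stab n r" "fiber_stab n c" by (rule young_filling[OF rc(1)])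
  have "(\<Sum>w\<in>words n A. \<Sum>p\<in>fiber_stab n w. coef p) / norm_const \<ge> 0"
    by (rule divide_nonneg_pos[OF sum_nonneg norm_const_pos], rule sum_coef_subgroup_nonneg, rule perm_group_fiber_stab)
  then show ?thesis by (simp only: word_mult_stab[OF rc])
qed

text \<open>By the pigeonhole principle a word repeats a letter within the first column. The transposition of
  the two places fixes the word and lies in the column stabiliser, so it changes the sign of every
  matrix coefficient while permuting the stabiliser of the word.\<close>
lemma word_mult_zero:
  assumes lam: "lam \<turnstile> n" and A: "finite A" and len: "card A < length lam"
  shows "word_mult n A lam = 0"
proof -
  obtain r c where rc: "filling n lam r c"
    "\<And>p. p permutes {..<n} \<Longrightarrow> rchar lam p = young.chi n (fiber_stab n r) (fiber_stab n c) p"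
    using rchar_young[OF lam] by metis
  interpret young n "fiber_stab n r" "fiber_stab n c" by (rule young_filling[OF rc(1)])
  let ?K = "{x. x < n \<and> c x = 0}"
  have "length lam = card {..<length lam}" by simp
  also have "\<dots> \<le> card (r ` ?K)"
  proof (intro card_mono subsetI)
    fix i assume "i \<in> {..<length lam}"
    then have "lam ! i \<in> set lam" by simp
    then have "lam ! i \<noteq> 0" using lam by (metis is_partition_def)
    then have "(i, 0) \<in> diagram lam"
      using \<open>i \<in> {..<length lam}\<close> by (simp add: diagram_def)
    then obtain x where "x < n" "r x = i" "c x = 0" by (rule filling_ex[OF rc(1)])
    then show "i \<in> r ` ?K" by auto
  qed auto
  also have "\<dots> \<le> card ?K" by (rule card_image_le) simp
  finally have K: "card A < card ?K" using len by simp
  have "(\<Sum>p\<in>fiber_stab n w. coef p) = 0" if w: "w \<in> words n A" for w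
  proof -
    have "\<not> inj_on w ?K"
    proof
      assume "inj_on w ?K"
      then have "card ?K \<le> card A" by (rule card_inj_on_le) (use w A in auto)
      with K show False by simp
    qed
    then obtain x y where xy: "x < n" "y < n" "c x = 0" "c y = 0" "x \<noteq> y" "w x = w y"
      by (auto simp: inj_on_def)
    define s where "s = Transposition.transpose x y"
    have s: "s permutes {..<n}" unfolding s_def by (rule permutes_swap_id) (use xy in auto)
    have sC: "s \<in> fiber_stab n c" using s xy by (auto simp: fiber_stab_def s_def transpose_def)
    have sw: "s \<in> fiber_stab n w" using s xy by (auto simp: fiber_stab_def s_def transpose_def)
    have sgn: "rsign s = -1" using xy by (simp add: rsign_def s_def sign_swap_id)
    have "(\<Sum>p\<in>fiber_stab n w. coef p) = (\<Sum>p\<in>fiber_stab n w. coef (p \<circ> s))"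
      by (rule sum_group_right[OF perm_group_fiber_stab sw, symmetric])
    also have "\<dots> = (\<Sum>p\<in>fiber_stab n w. - coef p)"
      by (intro sum.cong refl) (simp add: coef_right[OF sC] sgn perm_groupD(1)[OF perm_group_fiber_stab])
    finally show ?thesis by (simp add: sum_negf)
  qed
  then show ?thesis by (simp only: word_mult_stab[OF rc]) simp
qed

definition parts_le :: "nat \<Rightarrow> nat \<Rightarrow> nat list set" where
  "parts_le n k = {lam. lam \<turnstile> n \<and> length lam \<le> k}"

lemma finite_parts_le: "finite (parts_le n k)"
  by (rule finite_subset[OF _ finite_partitions[of n]]) (simp add: parts_le_def subset_iff)

lemma fixed_words_expansion:
  assumes A: "finite A" and p: "p permutes {..<n}"
  shows "fixed_words n A p = (\<Sum>lam\<in>parts_le n (card A). word_mult n A lam * rchar lam p)"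
proof -
  have "fixed_words n A p = (\<Sum>lam\<in>{lam. lam \<turnstile> n}. (\<Sum>q\<in>perms n. fixed_words n A q * rchar lam q) / fact n * rchar lam p)"
  proof (rule class_function_expansion[where ty = "cycle_type n" and P = "perms n"])
    show "cycle_type n ` perms n \<subseteq> {lam. lam \<turnstile> n}" using cycle_type by auto
    show "rchar lam p = rchar lam q" if "lam \<in> {lam. lam \<turnstile> n}" "p \<in> perms n" "q \<in> perms n" "cycle_type n p = cycle_type n q" for lam p q
      by (rule rchar_cycle_type[of lam n]) (use that in simp_all)
    show "fixed_words n A p = fixed_words n A q" if pq: "p \<in> perms n" "q \<in> perms n" "cycle_type n p = cycle_type n q" for p q
    proof -
      obtain g where "g permutes {..<n}" "p = inv g \<circ> q \<circ> g" using cycle_type_conj[of p n q] pq by auto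
      then show ?thesis using fixed_words_class[of q n g A] pq by simp
    qed
  qed (use p in \<open>simp_all add: finite_perms finite_partitions rchar_orth\<close>)
  also have "\<dots> = (\<Sum>lam\<in>{lam. lam \<turnstile> n}. word_mult n A lam * rchar lam p)" by (simp add: word_mult_def)
  also have "\<dots> = (\<Sum>lam\<in>parts_le n (card A). word_mult n A lam * rchar lam p)"
    by (rule sum.mono_neutral_right) (use word_mult_zero[OF _ A] in \<open>auto simp: finite_partitions parts_le_def not_le\<close>)
  finally show ?thesis .
qed

text \<open>Parseval's identity for the expansion of the character of words; its square is the character of
  words over pairs of letters.\<close>
lemma sum_word_mult_sq:
  assumes A: "finite A"
  shows "(\<Sum>lam\<in>parts_le n (card A). (word_mult n A lam)\<^sup>2) = real ((n + (card A)\<^sup>2 - 1) choose n)"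
proof -
  have m: "fact n * word_mult n A lam = (\<Sum>p\<in>perms n. fixed_words n A p * rchar lam p)" for lam
    by (simp add: word_mult_def)
  have "fact n * (\<Sum>lam\<in>parts_le n (card A). (word_mult n A lam)\<^sup>2) =
    (\<Sum>lam\<in>parts_le n (card A). word_mult n A lam * (\<Sum>p\<in>perms n. fixed_words n A p * rchar lam p))"
    unfolding m[symmetric] by (simp add: sum_distrib_left power2_eq_square mult_ac)
  also have "\<dots> = (\<Sum>p\<in>perms n. fixed_words n A p * (\<Sum>lam\<in>parts_le n (card A). word_mult n A lam * rchar lam p))"
    unfolding sum_distrib_left by (subst sum.swap) (simp add: mult_ac)
  also have "\<dots> = (\<Sum>p\<in>perms n. fixed_words n (A \<times> A) p)"
    by (intro sum.cong refl) (simp add: fixed_words_expansion[OF A, symmetric] fixed_words_Times)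
  also have "\<dots> = fact n * real ((n + (card A)\<^sup>2 - 1) choose n)"
    using A by (simp add: sum_fixed_words card_cartesian_product power2_eq_square)
  finally show ?thesis by simp
qed

section \<open>The lower bound for Kronecker coefficients\<close>

lemma Re_kronecker:
  assumes "lam \<turnstile> n" "mu \<turnstile> n" "nu \<turnstile> n"
  shows "Re (kronecker n lam mu nu) = (\<Sum>p\<in>perms n. rchar lam p * rchar mu p * rchar nu p) / fact n"
proof -
  have "kronecker n lam mu nu = of_real ((\<Sum>p\<in>perms n. rchar lam p * rchar mu p * rchar nu p) / fact n)"
    unfolding kronecker_def of_real_divide of_real_sum
    by (intro arg_cong2[where f = "(/)"] sum.cong) (simp_all add: specht_char_rchar[OF assms(1)] specht_char_rchar[OF assms(2)] specht_char_rchar[OF assms(3)])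
  then show ?thesis by (simp only: Re_complex_of_real)
qed

lemma kronecker_le_max:
  assumes "lam \<in> parts_le n k" "mu \<in> parts_le n k" "nu \<in> parts_le n k"
  shows "Re (kronecker n lam mu nu) \<le> max_kronecker n k"
proof -
  let ?S = "{Re (kronecker n lam mu nu) | lam mu nu.
     lam \<turnstile> n \<and> mu \<turnstile> n \<and> nu \<turnstile> n \<and> length lam \<le> k \<and> length mu \<le> k \<and> length nu \<le> k}"
  have "?S \<subseteq> (\<lambda>(lam, mu, nu). Re (kronecker n lam mu nu)) ` (parts_le n k \<times> parts_le n k \<times> parts_le n k)"
  proof clarify
    fix lam mu nu
    assume "lam \<turnstile> n" "mu \<turnstile> n" "nu \<turnstile> n" "length lam \<le> k" "length mu \<le> k" "length nu \<le> k"
    then have "(lam, mu, nu) \<in> parts_le n k \<times> parts_le n k \<times> parts_le n k" by (simp add: parts_le_def)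
    then show "Re (kronecker n lam mu nu) \<in> (\<lambda>(lam, mu, nu). Re (kronecker n lam mu nu)) ` (parts_le n k \<times> parts_le n k \<times> parts_le n k)"
      by (rule rev_image_eqI) simp
  qed
  then have "finite ?S" by (rule finite_subset) (simp add: finite_parts_le)
  then show ?thesis unfolding max_kronecker_def
    by (rule Max_ge) (use assms in \<open>auto simp: parts_le_def\<close>)
qed

text \<open>The left-hand side is the number of \<open>k \<times> k \<times> k\<close> arrays of nonnegative integers with sum \<open>n\<close>, which
  is the number of orbits on triples of words. Expanding the cube of the character of words expresses
  it as a combination of Kronecker coefficients with nonnegative weights.\<close>
lemma contingency_le_kronecker:
  "real ((n + k ^ 3 - 1) choose n) \<le> (\<Sum>lam\<in>parts_le n k. word_mult n {..<k} lam) ^ 3 * max_kronecker n k"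
proof -
  let ?A = "{..<k}" and ?L = "parts_le n k"
  let ?m = "word_mult n ?A"
  have "fact n * real ((n + k ^ 3 - 1) choose n) = (\<Sum>p\<in>perms n. fixed_words n (?A \<times> ?A \<times> ?A) p)"
    by (simp add: sum_fixed_words card_cartesian_product power3_eq_cube mult.assoc)
  also have "\<dots> = (\<Sum>p\<in>perms n. (\<Sum>lam\<in>?L. ?m lam * rchar lam p) * ((\<Sum>mu\<in>?L. ?m mu * rchar mu p) * (\<Sum>nu\<in>?L. ?m nu * rchar nu p)))"
    by (intro sum.cong refl) (simp add: fixed_words_Times fixed_words_expansion)
  also have "\<dots> = (\<Sum>p\<in>perms n. \<Sum>lam\<in>?L. \<Sum>mu\<in>?L. \<Sum>nu\<in>?L. ?m lam * ?m mu * ?m nu * (rchar lam p * rchar mu p * rchar nu p))"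
    unfolding sum_distrib_left sum_distrib_right by (simp add: mult_ac)
  also have "\<dots> = (\<Sum>lam\<in>?L. \<Sum>mu\<in>?L. \<Sum>nu\<in>?L. \<Sum>p\<in>perms n. ?m lam * ?m mu * ?m nu * (rchar lam p * rchar mu p * rchar nu p))"
    by (subst sum.swap, rule sum.cong[OF refl], subst sum.swap, rule sum.cong[OF refl], rule sum.swap)
  also have "\<dots> = (\<Sum>lam\<in>?L. \<Sum>mu\<in>?L. \<Sum>nu\<in>?L. fact n * (?m lam * ?m mu * ?m nu * Re (kronecker n lam mu nu)))"
    by (intro sum.cong refl) (simp add: Re_kronecker parts_le_def sum_distrib_left[symmetric])
  also have "\<dots> \<le> (\<Sum>lam\<in>?L. \<Sum>mu\<in>?L. \<Sum>nu\<in>?L. fact n * (?m lam * ?m mu * ?m nu * max_kronecker n k))"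
    by (intro sum_mono mult_left_mono kronecker_le_max mult_nonneg_nonneg word_mult_nonneg) (auto simp: parts_le_def)
  also have "\<dots> = fact n * ((\<Sum>lam\<in>?L. ?m lam) ^ 3 * max_kronecker n k)"
    unfolding power3_eq_cube sum_distrib_left sum_distrib_right by (simp add: mult_ac)
  finally show ?thesis by simp
qed

text \<open>Partitions with at most \<open>k\<close> parts become lists of length \<open>k\<close> by padding with zeros.\<close>
lemma card_parts_le: "card (parts_le n k) \<le> (n + k - 1) choose n"
proof -
  let ?f = "\<lambda>lam. lam @ replicate (k - length lam) 0"
  have "inj_on ?f (parts_le n k)"
  proof (rule inj_on_inverseI[where g = "filter (\<lambda>x. x \<noteq> 0)"])
    show "filter (\<lambda>x. x \<noteq> 0) (?f lam) = lam" if "lam \<in> parts_le n k" for lam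
      using that by (auto simp: parts_le_def is_partition_def filter_id_conv intro!: gr0I)
  qed
  moreover have "?f ` parts_le n k \<subseteq> {l. length l = k \<and> sum_list l = n}"
    by (auto simp: parts_le_def is_partition_def sum_list_replicate)
  moreover have "finite {l :: nat list. length l = k \<and> sum_list l = n}"
    by (rule finite_subset[OF _ finite_lists_length_eq[of "{..n}" k]]) (auto intro: member_le_sum_list)
  ultimately have "card (parts_le n k) \<le> card {l :: nat list. length l = k \<and> sum_list l = n}"
    by (rule card_inj_on_le)
  then show ?thesis by (simp only: card_length_sum_list)
qed

lemma binomial_bounds:
  "(n + e) choose n \<le> (n + 1) ^ e" "n ^ e \<le> fact e * ((n + e) choose n)"
proof -
  have *: "Suc e * ((n + Suc e) choose n) = (n + Suc e) * ((n + e) choose n)" for e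
    using Suc_times_binomial[of e "n + e"] binomial_symmetric[of n "n + Suc e"] binomial_symmetric[of n "n + e"] by simp
  show "(n + e) choose n \<le> (n + 1) ^ e"
  proof (induction e)
    case (Suc e)
    have "Suc e * ((n + Suc e) choose n) \<le> (Suc e * (n + 1)) * (n + 1) ^ e"
      unfolding * by (intro mult_mono Suc.IH) auto
    then have "Suc e * ((n + Suc e) choose n) \<le> Suc e * (n + 1) ^ Suc e"
      by (simp only: power_Suc mult.assoc)
    then show ?case by (simp only: mult_le_cancel1 zero_less_Suc simp_thms)
  qed simp
  show "n ^ e \<le> fact e * ((n + e) choose n)"
  proof (induction e)
    case (Suc e)
    have "n ^ Suc e \<le> (n + Suc e) * (fact e * ((n + e) choose n))"
      unfolding power_Suc by (intro mult_mono Suc.IH) auto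
    also have "\<dots> = fact e * (Suc e * ((n + Suc e) choose n))" unfolding * by (simp add: mult_ac)
    also have "\<dots> = fact (Suc e) * ((n + Suc e) choose n)" by (simp only: fact_Suc of_nat_id mult_ac)
    finally show ?case .
  qed simp
qed

text \<open>Since \<open>m \<le> 1 + m\<^sup>2\<close>, the bound on the squares already controls the sum; for \<open>k \<ge> 1\<close> the number of partitions
  is no larger than the bound on the squares.\<close>
lemma sum_word_mult_le:
  assumes k: "k \<ge> 1"
  shows "(\<Sum>lam\<in>parts_le n k. word_mult n {..<k} lam) \<le> 2 * real (n + 1) ^ (k\<^sup>2 - 1)"
proof -
  have kk: "k \<le> k\<^sup>2" by (simp add: power2_eq_square)
  have "(\<Sum>lam\<in>parts_le n k. word_mult n {..<k} lam) \<le> (\<Sum>lam\<in>parts_le n k. 1 + (word_mult n {..<k} lam)\<^sup>2)"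
  proof (rule sum_mono)
    fix lam
    show "word_mult n {..<k} lam \<le> 1 + (word_mult n {..<k} lam)\<^sup>2"
    proof -
      have "2 * word_mult n {..<k} lam \<le> (word_mult n {..<k} lam)\<^sup>2 + 1"
        using zero_le_power2[of "word_mult n {..<k} lam - 1"] by (simp add: power2_diff)
      then show ?thesis using zero_le_power2[of "word_mult n {..<k} lam"] by linarith
    qed
  qed
  also have "\<dots> = real (card (parts_le n k)) + real ((n + k\<^sup>2 - 1) choose n)"
    using sum_word_mult_sq[of "{..<k}" n] by (simp add: sum.distrib)
  also have "card (parts_le n k) \<le> (n + k\<^sup>2 - 1) choose n"
    by (rule order_trans[OF card_parts_le binomial_right_mono]) (use kk in simp)
  also have "(n + k\<^sup>2 - 1) choose n \<le> (n + 1) ^ (k\<^sup>2 - 1)"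
    using binomial_bounds(1)[of n "k\<^sup>2 - 1"] k by simp
  finally show ?thesis by simp
qed

theorem theorem1p5:
  fixes k :: nat
  assumes "k \<ge> 1"
  shows "\<exists>C::real. C > 0 \<and> (\<forall>n::nat. n \<ge> 1 \<longrightarrow>
    max_kronecker n k \<ge> C * real n powi (int k ^ 3 - 3 * int k ^ 2 - 3 * int k + 3))"
proof -
  define e where "e = k\<^sup>2 - 1"
  define d where "d = k ^ 3 - 1"
  define C :: real where "C = 1 / (fact d * 8 ^ (e + 1))"
  have "C > 0" by (simp add: C_def)
  moreover have "max_kronecker n k \<ge> C * real n powi (int k ^ 3 - 3 * int k ^ 2 - 3 * int k + 3)"
    if n: "n \<ge> 1" for n
  proof -
    let ?M = "max_kronecker n k" and ?S = "\<Sum>lam\<in>parts_le n k. word_mult n {..<k} lam"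
    have S0: "?S \<ge> 0" by (intro sum_nonneg word_mult_nonneg) (simp add: parts_le_def)
    have "real n ^ d \<le> fact d * real ((n + d) choose n)"
      using binomial_bounds(2)[of n d] by (metis of_nat_fact of_nat_le_iff of_nat_mult of_nat_power)
    also have "n + d = n + k ^ 3 - 1" using assms by (simp add: d_def)
    also have "fact d * real ((n + k ^ 3 - 1) choose n) \<le> fact d * (?S ^ 3 * ?M)"
      by (intro mult_left_mono contingency_le_kronecker) simp
    finally have 1: "real n ^ d \<le> fact d * (?S ^ 3 * ?M)" .
    moreover have "real n ^ d > 0" using n by simp
    ultimately have "0 < ?S ^ 3 * ?M" by (metis less_le_trans fact_gt_zero zero_less_mult_pos)
    then have M: "?M > 0" using S0 by (simp add: zero_less_mult_iff)
    \<comment> \<open>The bound \<open>n + 1 \<le> 2 * n\<close> makes it a monomial in \<open>n\<close>; its constant factor \<open>2 * 2 ^ e\<close> is cubed in \<open>C\<close>.\<close>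
    have "?S \<le> 2 * (2 * real n) ^ e"
    proof -
      have "?S \<le> 2 * real (n + 1) ^ e" unfolding e_def by (rule sum_word_mult_le[OF assms])
      also have "\<dots> \<le> 2 * (2 * real n) ^ e" using n by (intro mult_left_mono power_mono) auto
      finally show ?thesis .
    qed
    then have "?S ^ 3 \<le> (2 * (2 * real n) ^ e) ^ 3" using S0 by (rule power_mono)
    also have "\<dots> = 8 ^ (e + 1) * real n ^ (3 * e)"
      by (simp add: power_mult_distrib power_mult[symmetric] mult.commute[of e]) (simp add: power_mult)
    finally have 3: "fact d * (?S ^ 3 * ?M) \<le> fact d * (8 ^ (e + 1) * real n ^ (3 * e) * ?M)"
      using M by (intro mult_left_mono mult_right_mono) auto
    have 2: "real n ^ d \<le> (fact d * 8 ^ (e + 1)) * (real n ^ (3 * e) * ?M)"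
      using order_trans[OF 1 3] by (simp add: mult_ac)
    have "int d = int k ^ 3 - 1" "int e = int k ^ 2 - 1"
      using assms by (simp_all add: d_def e_def of_nat_diff)
    then have ex: "int k ^ 3 - 3 * int k ^ 2 - 3 * int k + 3 \<le> int d - int (3 * e)" using assms by simp
    have "C * real n powi (int k ^ 3 - 3 * int k ^ 2 - 3 * int k + 3) \<le> C * real n powi (int d - int (3 * e))"
      using n \<open>C > 0\<close> by (intro mult_left_mono power_int_increasing[OF ex]) auto
    also have "\<dots> = C * (real n ^ d / real n ^ (3 * e))"
      using n power_int_diff[of "real n" "int d" "int (3 * e)"] by (simp only: power_int_of_nat) simp
    also have "\<dots> \<le> ?M"
      using 2 n by (simp add: C_def field_simps)
    finally show ?thesis .
  qed
  ultimately show ?thesis by blast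
qed

end
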